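(* With $h_{\mathrm{sym}}(\ell)$ the topological entropy of the symbolic system of $\mathcal{F}_\ell|_{\mathcal{K}_\ell}$, we have $\lim_{\ell\to\infty}h_{\mathrm{sym}}(\ell)=\log(1+\sqrt2)$.
   Context: Stadium billiard: $\Omega_\ell$ ($\ell>1$) is bounded by the closed pieces $P_B=[0,\ell]\times\{-1\}$, $P_T=[0,\ell]\times\{1\}$, $P_L=\{x\le0,\ x^2+y^2=1\}$, $P_R=\{x\ge\ell,\ (x-\ell)^2+y^2=1\}$; $\mathcal{M}_\ell=\partial\Omega_\ell\times[-\pi/2,\pi/2]$ is the phase space and $\mathcal{F}_\ell$ the billiard map. $\mathcal{K}_\ell$ is the set of points of $\mathcal{M}_\ell$ whose full trajectory is defined and has no two consecutive collisions with the same semicircle. An itinerary of $x$ is $\omega\in\{L,R,T,B\}^{\mathbb{Z}}$ with the boundary point of $\mathcal{F}_\ell^n(x)$ in $P_{\omega_n}$ for all $n$. $h_{\mathrm{sym}}(\ell)=\limsup_{n\to\infty}\frac1n\log W_n(\ell)$, where $W_n(\ell)$ is the number of distinct words of length $n$ occurring as blocks of itineraries of points of $\mathcal{K}_\ell$. *)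

theory Defs
  imports Complex_Main "HOL-Library.Extended_Real"
begin

text \<open>Stadium billiard with straight pieces of length l and semicircles of radius 1.
  Points of the plane are pairs of reals; phase points are (q, phi) with q on the
  boundary and phi in [-pi/2, pi/2] the angle of the outgoing velocity with the
  inward unit normal at q (measured counterclockwise).\<close>

datatype side = L | R | T | B

definition piece :: "real \<Rightarrow> side \<Rightarrow> (real \<times> real) set" where
  "piece l s = (case s of
      B \<Rightarrow> {(x, y). 0 \<le> x \<and> x \<le> l \<and> y = -1}
    | T \<Rightarrow> {(x, y). 0 \<le> x \<and> x \<le> l \<and> y = 1}
    | L \<Rightarrow> {(x, y). x \<le> 0 \<and> x\<^sup>2 + y\<^sup>2 = 1}
    | R \<Rightarrow> {(x, y). l \<le> x \<and> (x - l)\<^sup>2 + y\<^sup>2 = 1})"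

definition stadium_boundary :: "real \<Rightarrow> (real \<times> real) set" where
  "stadium_boundary l = (\<Union>s. piece l s)"

definition phase_space :: "real \<Rightarrow> ((real \<times> real) \<times> real) set" where
  "phase_space l = stadium_boundary l \<times> {-pi/2 .. pi/2}"

text \<open>Inward unit normal (the boundary is C^1, so this is well defined at the junctions).\<close>
definition inward_normal :: "real \<Rightarrow> real \<times> real \<Rightarrow> real \<times> real" where
  "inward_normal l q = (let x = fst q; y = snd q in
      if x < 0 then (-x, -y) else if l < x then (l - x, -y) else (0, -y))"

definition rot :: "real \<Rightarrow> real \<times> real \<Rightarrow> real \<times> real" where
  "rot phi v = (cos phi * fst v - sin phi * snd v, sin phi * fst v + cos phi * snd v)"

definition ray :: "real \<times> real \<Rightarrow> real \<times> real \<Rightarrow> real \<Rightarrow> real \<times> real" where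
  "ray q v t = (fst q + t * fst v, snd q + t * snd v)"

definition first_hit :: "real \<Rightarrow> real \<times> real \<Rightarrow> real \<times> real \<Rightarrow> real \<Rightarrow> bool" where
  "first_hit l q v t \<longleftrightarrow> 0 < t \<and> ray q v t \<in> stadium_boundary l \<and>
      (\<forall>s. 0 < s \<and> s < t \<longrightarrow> ray q v s \<notin> stadium_boundary l)"

definition reflect :: "real \<times> real \<Rightarrow> real \<times> real \<Rightarrow> real \<times> real" where
  "reflect v n = (let c = fst v * fst n + snd v * snd n in
      (fst v - 2 * c * fst n, snd v - 2 * c * snd n))"

definition billiard_map :: "real \<Rightarrow> (real \<times> real) \<times> real \<Rightarrow> ((real \<times> real) \<times> real) option" where
  "billiard_map l x = (let q = fst x; phi = snd x; v = rot phi (inward_normal l q) in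
     if x \<in> phase_space l \<and> (\<exists>t. first_hit l q v t) then
       (let t = (THE t. first_hit l q v t); q' = ray q v t; n' = inward_normal l q';
            v' = reflect v n' in
          Some (q', arcsin (fst n' * snd v' - snd n' * fst v')))
     else None)"

definition full_orbit :: "real \<Rightarrow> (real \<times> real) \<times> real \<Rightarrow> (int \<Rightarrow> (real \<times> real) \<times> real) \<Rightarrow> bool" where
  "full_orbit l x xs \<longleftrightarrow> xs 0 = x \<and> (\<forall>n. billiard_map l (xs n) = Some (xs (n + 1)))"

definition K_set :: "real \<Rightarrow> ((real \<times> real) \<times> real) set" where
  "K_set l = {x. \<exists>xs. full_orbit l x xs \<and>
      (\<forall>n. \<not> (fst (xs n) \<in> piece l L \<and> fst (xs (n + 1)) \<in> piece l L) \<and>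
           \<not> (fst (xs n) \<in> piece l R \<and> fst (xs (n + 1)) \<in> piece l R))}"

definition itinerary :: "real \<Rightarrow> (real \<times> real) \<times> real \<Rightarrow> (int \<Rightarrow> side) \<Rightarrow> bool" where
  "itinerary l x w \<longleftrightarrow> (\<exists>xs. full_orbit l x xs \<and> (\<forall>n. fst (xs n) \<in> piece l (w n)))"

definition W_count :: "real \<Rightarrow> nat \<Rightarrow> nat" where
  "W_count l n = card {u :: side list. length u = n \<and>
      (\<exists>x \<in> K_set l. \<exists>w. itinerary l x w \<and>
         (\<exists>k::int. u = map (\<lambda>i. w (k + int i)) [0..<n]))}"

definition h_sym :: "real \<Rightarrow> ereal" where
  "h_sym l = limsup (\<lambda>n. ereal (ln (real (W_count l n)) / real n))"

end

theory Submission
  imports Defs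
begin

text \<open>Between two visits to the semicircles the ball moves monotonically along the table and
  alternates between top and bottom, and without consecutive collisions with the same semicircle
  the visits to L and R alternate.  Up to the choice of the first semicircle, words are therefore
  words in three letters in which T and B are not repeated, whose number grows like
  (1 + sqrt 2) ^ n; this bounds the entropy from above for every l.

  Conversely, any sequence of zigzags of at most N flat collisions is realised once l is at least
  16 (N + 1).  After unfolding the strip, all chords between semicircles are nearly horizontal, and
  the law of reflection becomes a fixed point equation for the angles of the collision points on
  the semicircles, whose right hand side contracts by the factor 1/2 in the supremum norm.\<close>

section \<open>Words\<close>

text \<open>The count of zigzag words is independent of l; the geometry enters the lower bound only
  through the demand that chords be flat enough, so N can grow with l. The bound uses blocks made of
  an L and an arbitrary zigzag word of length N. The leading L lets blocks be concatenated without
  compatibility conditions and bounds the number of successive flat collisions; it costs one letter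
  in N + 1, hence the rate N / (N + 1) * ln (1 + sqrt 2). The obstacle is that the reflection laws
  at all semicircle collisions, past and future, are coupled, each angle depending on its two
  neighbours. A long table weakens the coupling, since \<open>slope\<close> has l in its
  denominator, and a contraction on whole bi-infinite sequences solves all equations at once,
  without limits of finite orbits. The bound 1/4 on the angles keeps semicircle collisions away from
  the junctions.\<close>

text \<open>Since the visits to the two semicircles alternate, a word is determined by its
  first semicircle and by the word in which both L and R are written as L.\<close>

fun forget :: "side \<Rightarrow> side" where
  "forget R = L"
| "forget s = s"

text \<open>\<open>p\<close> is the letter preceding the word. Repeating \<open>L\<close> is allowed
  because after \<open>forget\<close> it stands for a passage between the two semicircles.\<close>

fun zigzag :: "side \<Rightarrow> side list \<Rightarrow> bool" where
  "zigzag p [] \<longleftrightarrow> True"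
| "zigzag p (s # u) \<longleftrightarrow> s \<noteq> R \<and> (s = p \<longrightarrow> s = L) \<and> zigzag s u"

definition zigzags :: "side \<Rightarrow> nat \<Rightarrow> side list set" where
  "zigzags p n = {u. length u = n \<and> zigzag p u}"

fun flip :: "side \<Rightarrow> side" where
  "flip L = R"
| "flip R = L"
| "flip s = s"

fun alternate :: "side \<Rightarrow> side list \<Rightarrow> side list" where
  "alternate d [] = []"
| "alternate d (s # u) = (if s = L then d # alternate (flip d) u else s # alternate d u)"

section \<open>Counting zigzag words\<close>

lemma UNIV_side: "(UNIV :: side set) = {L, R, T, B}"
  by (auto intro: side.exhaust)

lemma finite_side [simp]: "finite (X :: side set)"
  by (metis UNIV_side finite.emptyI finite.insertI finite_subset subset_UNIV)

lemma finite_lists_length_side: "finite {u :: side list. length u = n \<and> P u}"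
  by (rule finite_subset[OF _ finite_lists_length_eq[of "UNIV :: side set" n]]) auto

lemma finite_zigzags [simp]: "finite (zigzags p n)"
  unfolding zigzags_def by (rule finite_lists_length_side)

lemma zigzags_0 [simp]: "zigzags p 0 = {[]}"
  by (auto simp: zigzags_def)

lemma zigzags_Suc:
  "zigzags p (Suc n) = (\<Union>s\<in>{s. s \<noteq> R \<and> (s = p \<longrightarrow> s = L)}. (#) s ` zigzags s n)"
  by (auto simp: zigzags_def length_Suc_conv)

lemma card_zigzags_Suc:
  "card (zigzags p (Suc n)) = (\<Sum>s\<in>{s. s \<noteq> R \<and> (s = p \<longrightarrow> s = L)}. card (zigzags s n))"
  unfolding zigzags_Suc
  by (subst card_UN_disjoint) (auto intro!: sum.cong simp: card_image)

lemma card_zigzags_rec: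
  "card (zigzags L (Suc n)) = card (zigzags L n) + card (zigzags T n) + card (zigzags B n)"
  "card (zigzags T (Suc n)) = card (zigzags L n) + card (zigzags B n)"
  "card (zigzags B (Suc n)) = card (zigzags L n) + card (zigzags T n)"
proof -
  have "{s. s \<noteq> R \<and> (s = L \<longrightarrow> s = L)} = {L, T, B}" "{s. s \<noteq> R \<and> (s = T \<longrightarrow> s = L)} = {L, B}"
    "{s. s \<noteq> R \<and> (s = B \<longrightarrow> s = L)} = {L, T}"
    using UNIV_side by auto
  then show
    "card (zigzags L (Suc n)) = card (zigzags L n) + card (zigzags T n) + card (zigzags B n)"
    "card (zigzags T (Suc n)) = card (zigzags L n) + card (zigzags B n)"
    "card (zigzags B (Suc n)) = card (zigzags L n) + card (zigzags T n)"
    by (simp_all only: card_zigzags_Suc) simp_all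
qed

text \<open>The weights (sqrt 2, 1, 1) on the last letters L, T, B form an eigenvector of the
  transition matrix for the eigenvalue 1 + sqrt 2.\<close>

lemma card_zigzags_le:
  "real (card (zigzags L n)) \<le> sqrt 2 * (1 + sqrt 2) ^ n \<and>
   real (card (zigzags T n)) \<le> (1 + sqrt 2) ^ n \<and> real (card (zigzags B n)) \<le> (1 + sqrt 2) ^ n"
proof (induction n)
  case (Suc n)
  have "sqrt 2 * (1 + sqrt 2) ^ Suc n
      = sqrt 2 * (1 + sqrt 2) ^ n + (sqrt 2 * sqrt 2) * (1 + sqrt 2) ^ n"
    by (simp only: power_Suc) algebra
  then have "sqrt 2 * (1 + sqrt 2) ^ Suc n
      = sqrt 2 * (1 + sqrt 2) ^ n + 2 * (1 + sqrt 2) ^ n"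
    by simp
  moreover have "(1 + sqrt 2) ^ Suc n = sqrt 2 * (1 + sqrt 2) ^ n + (1 + sqrt 2) ^ n"
    by (simp add: algebra_simps)
  ultimately show ?case
    using Suc by (simp only: card_zigzags_rec of_nat_add) linarith
qed simp

text \<open>The same eigenvector divided by sqrt 2 lies below the counts at n = 0, which are all 1,
  and the recursion preserves the inequality.\<close>

lemma card_zigzags_ge:
  "real (card (zigzags L n)) \<ge> (1 + sqrt 2) ^ n \<and>
   sqrt 2 * real (card (zigzags T n)) \<ge> (1 + sqrt 2) ^ n \<and>
   sqrt 2 * real (card (zigzags B n)) \<ge> (1 + sqrt 2) ^ n"
proof (induction n)
  case (Suc n)
  define l t b x where "l = real (card (zigzags L n))" "t = real (card (zigzags T n))"
    "b = real (card (zigzags B n))" "x = (1 + sqrt 2) ^ n"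
  have IH: "l \<ge> x" "sqrt 2 * t \<ge> x" "sqrt 2 * b \<ge> x"
    using Suc by (auto simp: l_t_b_x_def)
  have "sqrt 2 * (sqrt 2 * t) \<ge> sqrt 2 * x" "sqrt 2 * (sqrt 2 * b) \<ge> sqrt 2 * x"
    "sqrt 2 * l \<ge> sqrt 2 * x"
    using IH by simp_all
  then have "2 * t \<ge> sqrt 2 * x" "2 * b \<ge> sqrt 2 * x" "sqrt 2 * l \<ge> sqrt 2 * x"
    by (simp_all flip: mult.assoc)
  with IH have "l + t + b \<ge> x + sqrt 2 * x" "sqrt 2 * (l + b) \<ge> x + sqrt 2 * x"
    "sqrt 2 * (l + t) \<ge> x + sqrt 2 * x"
    by (simp_all only: ring_distribs)
  then show ?case
    by (simp add: card_zigzags_rec l_t_b_x_def algebra_simps)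
qed simp

section \<open>From itineraries to zigzag words\<close>

lemma forget_eq_L_iff: "forget s = L \<longleftrightarrow> s = L \<or> s = R"
  by (cases s) auto

lemma forget_neq_R [simp]: "forget s \<noteq> R"
  by (cases s) auto

lemma zigzag_map_forget:
  fixes w :: "int \<Rightarrow> side"
  assumes "\<And>n. forget (w n) = forget (w (n + 1)) \<Longrightarrow> forget (w n) = L"
  shows "zigzag (forget (w (k - 1))) (map (\<lambda>i. forget (w (k + int i))) [0..<n])"
proof (induction n arbitrary: k)
  case (Suc n)
  have "map (\<lambda>i. forget (w (k + int i))) [0..<Suc n]
      = forget (w k) # map (\<lambda>i. forget (w (k + 1 + int i))) [0..<n]"
    by (simp only: upt_conv_Cons map_Suc_upt[symmetric] zero_less_Suc list.map map_map) (simp add: algebra_simps o_def)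
  moreover have "zigzag (forget (w k)) (map (\<lambda>i. forget (w (k + 1 + int i))) [0..<n])"
    using Suc[of "k + 1"] by simp
  ultimately show ?case
    using assms[of "k - 1"] by auto
qed simp

lemma zigzag_L: "zigzag p u \<Longrightarrow> zigzag L u"
  by (cases u) auto

text \<open>The hypothesis on \<open>d\<close> concerns only the first semicircle from
  \<open>k\<close> on. In this form the induction passes a flat letter with \<open>d\<close>
  unchanged and a semicircle with \<open>flip d\<close>.\<close>

lemma alternate_map_forget:
  fixes w :: "int \<Rightarrow> side"
  assumes alt: "\<And>a b. a < b \<Longrightarrow> forget (w a) = L \<Longrightarrow> forget (w b) = L \<Longrightarrow>
      (\<And>i. a < i \<Longrightarrow> i < b \<Longrightarrow> forget (w i) \<noteq> L) \<Longrightarrow> w b = flip (w a)"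
    and "\<And>j. k \<le> j \<Longrightarrow> forget (w j) = L \<Longrightarrow>
      (\<And>i. k \<le> i \<Longrightarrow> i < j \<Longrightarrow> forget (w i) \<noteq> L) \<Longrightarrow> w j = d"
  shows "map (\<lambda>i. w (k + int i)) [0..<n] = alternate d (map (\<lambda>i. forget (w (k + int i))) [0..<n])"
  using assms(2)
proof (induction n arbitrary: k d)
  case (Suc n)
  have shift: "map (\<lambda>i. f (k + int i)) [0..<Suc n] = f k # map (\<lambda>i. f (k + 1 + int i)) [0..<n]"
    for f :: "int \<Rightarrow> side"
    by (simp only: upt_conv_Cons map_Suc_upt[symmetric] zero_less_Suc list.map map_map) (simp add: algebra_simps o_def)
  show ?case
  proof (cases "forget (w k) = L")
    case True
    then have "w k = d"
      using Suc.prems[of k] by simp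
    moreover have "map (\<lambda>i. w (k + 1 + int i)) [0..<n]
        = alternate (flip d) (map (\<lambda>i. forget (w (k + 1 + int i))) [0..<n])"
    proof (rule Suc.IH)
      fix j assume "k + 1 \<le> j" "forget (w j) = L" "\<And>i. k + 1 \<le> i \<Longrightarrow> i < j \<Longrightarrow> forget (w i) \<noteq> L"
      then show "w j = flip d"
        using alt[of k j] True \<open>w k = d\<close> by simp
    qed
    ultimately show ?thesis
      using True by (simp only: shift[of w] shift[of "\<lambda>i. forget (w i)"]) simp
  next
    case False
    have "map (\<lambda>i. w (k + 1 + int i)) [0..<n]
        = alternate d (map (\<lambda>i. forget (w (k + 1 + int i))) [0..<n])"
    proof (rule Suc.IH)
      fix j assume j: "k + 1 \<le> j" "forget (w j) = L" "\<And>i. k + 1 \<le> i \<Longrightarrow> i < j \<Longrightarrow> forget (w i) \<noteq> L"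
      show "w j = d"
      proof (rule Suc.prems)
        show "forget (w i) \<noteq> L" if "k \<le> i" "i < j" for i
          using j(3)[of i] False that by (cases "i = k") auto
      qed (use j in auto)
    qed
    moreover have "forget (w k) = w k"
      using False by (cases "w k") auto
    ultimately show ?thesis
      using False by (simp only: shift[of w] shift[of "\<lambda>i. forget (w i)"]) simp
  qed
qed simp

lemma map_in_alternate_zigzags:
  fixes w :: "int \<Rightarrow> side"
  assumes "\<And>n. forget (w n) = forget (w (n + 1)) \<Longrightarrow> forget (w n) = L"
    and alt: "\<And>a b. a < b \<Longrightarrow> forget (w a) = L \<Longrightarrow> forget (w b) = L \<Longrightarrow>
      (\<And>i. a < i \<Longrightarrow> i < b \<Longrightarrow> forget (w i) \<noteq> L) \<Longrightarrow> w b = flip (w a)"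
  shows "map (\<lambda>i. w (k + int i)) [0..<n] \<in> alternate L ` zigzags L n \<union> alternate R ` zigzags L n"
proof -
  define first where "first j \<longleftrightarrow> k \<le> j \<and> forget (w j) = L \<and>
    (\<forall>i. k \<le> i \<and> i < j \<longrightarrow> forget (w i) \<noteq> L)" for j
  have uniq: "i = j" if "first i" "first j" for i j
    using that unfolding first_def by (meson linorder_neqE)
  \<comment> \<open>If no semicircle occurs from \<open>k\<close> on, either choice of
    \<open>d\<close> works.\<close>
  have "\<exists>d\<in>{L, R}. \<forall>j. first j \<longrightarrow> w j = d"
  proof (cases "\<exists>j. first j")
    case True
    then obtain j where "first j" by blast
    then have "w j \<in> {L, R}" "\<forall>i. first i \<longrightarrow> w i = w j"
      using uniq by (auto simp: first_def forget_eq_L_iff)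
    then show ?thesis by blast
  qed auto
  then obtain d where d: "d \<in> {L, R}" "\<And>j. first j \<Longrightarrow> w j = d" by blast
  have "map (\<lambda>i. w (k + int i)) [0..<n]
      = alternate d (map (\<lambda>i. forget (w (k + int i))) [0..<n])"
    by (rule alternate_map_forget[OF alt]) (auto simp: first_def intro!: d(2))
  moreover have "map (\<lambda>i. forget (w (k + int i))) [0..<n] \<in> zigzags L n"
    using zigzag_L[OF zigzag_map_forget[of w k n]] assms(1) by (simp add: zigzags_def)
  ultimately show ?thesis
    using d(1) by auto
qed

section \<open>The billiard map\<close>

lemma mem_boundary_iff:
  "(x, y) \<in> stadium_boundary l \<longleftrightarrow>
     0 \<le> x \<and> x \<le> l \<and> (y = -1 \<or> y = 1) \<or> x \<le> 0 \<and> x\<^sup>2 + y\<^sup>2 = 1 \<or> l \<le> x \<and> (x - l)\<^sup>2 + y\<^sup>2 = 1"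
proof -
  have "stadium_boundary l = \<Union> (piece l ` {L, R, T, B})"
    by (simp only: stadium_boundary_def UNIV_side)
  then show ?thesis
    by (auto simp: piece_def)
qed

lemma piece_subset_boundary: "piece l s \<subseteq> stadium_boundary l"
  by (auto simp: stadium_boundary_def)

lemma abs_snd_boundary_le:
  assumes "(x, y) \<in> stadium_boundary l"
  shows "\<bar>y\<bar> \<le> 1"
proof -
  have "y\<^sup>2 \<le> 1" if "a\<^sup>2 + y\<^sup>2 = 1" for a :: real
    using that zero_le_power2[of a] by linarith
  then show ?thesis
    using assms by (auto simp: mem_boundary_iff abs_square_le_1)
qed

lemma norm_inward_normal:
  assumes "q \<in> stadium_boundary l" "0 < l"
  shows "(fst (inward_normal l q))\<^sup>2 + (snd (inward_normal l q))\<^sup>2 = 1"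
  using assms by (cases q) (auto simp: mem_boundary_iff inward_normal_def power2_commute)

text \<open>Cauchy-Schwarz with its equality case, read off from the squared distance of two points
  of the unit circle.\<close>

lemma circle_inner_le:
  fixes a b c d :: real
  assumes "a\<^sup>2 + b\<^sup>2 = 1" "c\<^sup>2 + d\<^sup>2 = 1"
  shows "a * c + b * d \<le> 1" "a * c + b * d = 1 \<Longrightarrow> c = a \<and> d = b"
proof -
  have *: "(a - c)\<^sup>2 + (b - d)\<^sup>2 = 2 - 2 * (a * c + b * d)"
    using assms by (simp add: power2_eq_square algebra_simps)
  moreover have "0 \<le> (a - c)\<^sup>2 + (b - d)\<^sup>2"
    by simp
  ultimately have "0 \<le> 2 - 2 * (a * c + b * d)"
    by simp
  then show "a * c + b * d \<le> 1"
    by simp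
  show "c = a \<and> d = b" if "a * c + b * d = 1"
    using * that by (simp add: sum_power2_eq_zero_iff)
qed

definition inner2 :: "real \<times> real \<Rightarrow> real \<times> real \<Rightarrow> real" where
  "inner2 u v = fst u * fst v + snd u * snd v"

text \<open>The tangent to the left semicircle is a supporting line. For points with
  \<open>x' \<le> 0\<close> this is Cauchy-Schwarz; for \<open>x' > 0\<close> the product
  \<open>x * x'\<close> is nonpositive and the heights are at most 1 in absolute value.\<close>

lemma support_left:
  assumes "0 < l" "x \<le> 0" "x\<^sup>2 + y\<^sup>2 = 1" "(x', y') \<in> stadium_boundary l"
  shows "x * x' + y * y' \<le> 1" "x < 0 \<Longrightarrow> x * x' + y * y' = 1 \<Longrightarrow> x' = x \<and> y' = y"
proof -
  have y: "y * y' \<le> 1"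
  proof -
    have "\<bar>y\<bar> \<le> 1"
      using abs_snd_boundary_le[of x y l] assms by (simp add: mem_boundary_iff)
    moreover have "\<bar>y'\<bar> \<le> 1"
      using abs_snd_boundary_le assms by blast
    ultimately have "\<bar>y\<bar> * \<bar>y'\<bar> \<le> 1 * 1"
      by (intro mult_mono) auto
    then show ?thesis
      by (metis abs_le_D1 abs_mult mult_1)
  qed
  consider "x' \<le> 0" "x'\<^sup>2 + y'\<^sup>2 = 1" | "0 \<le> x'" "x' = 0 \<Longrightarrow> x'\<^sup>2 + y'\<^sup>2 = 1"
    using assms(1,4) by (fastforce simp: mem_boundary_iff)
  then have "x * x' + y * y' \<le> 1 \<and> (x < 0 \<longrightarrow> x * x' + y * y' = 1 \<longrightarrow> x' = x \<and> y' = y)"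
  proof cases
    case 1
    then show ?thesis
      using circle_inner_le[of x y x' y'] assms by auto
  next
    case 2
    show ?thesis
    proof (cases "x' = 0")
      case True
      then show ?thesis
        using 2 circle_inner_le[of x y x' y'] assms by auto
    next
      case False
      then have "x * x' \<le> 0" "x < 0 \<Longrightarrow> x * x' < 0"
        using 2 assms by (auto simp: mult_nonpos_nonneg mult_neg_pos)
      then show ?thesis
        using y by auto
    qed
  qed
  then show "x * x' + y * y' \<le> 1" "x < 0 \<Longrightarrow> x * x' + y * y' = 1 \<Longrightarrow> x' = x \<and> y' = y"
    by auto
qed

lemma mirror_boundary: "(l - x, y) \<in> stadium_boundary l \<longleftrightarrow> (x, y) \<in> stadium_boundary l"
  by (auto simp: mem_boundary_iff power2_commute)

text \<open>Convexity in the form used below: the boundary lies on the inner side of each of its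
  tangents, and a tangent meets it elsewhere only along a flat side. The right semicircle is reduced
  to the left one by mirror symmetry.\<close>

lemma inner_normal_ge:
  assumes "0 < l" "(x, y) \<in> stadium_boundary l" "(x', y') \<in> stadium_boundary l"
  shows "inner2 (inward_normal l (x, y)) (x' - x, y' - y) \<ge> 0"
    and "inner2 (inward_normal l (x, y)) (x' - x, y' - y) = 0 \<Longrightarrow>
      x' = x \<and> y' = y \<or> 0 \<le> x \<and> x \<le> l \<and> y' = y \<and> (y = -1 \<or> y = 1)"
proof -
  consider "x < 0" "x\<^sup>2 + y\<^sup>2 = 1" | "l < x" "(x - l)\<^sup>2 + y\<^sup>2 = 1" | "0 \<le> x" "x \<le> l" "y = -1 \<or> y = 1"
    using assms(1,2) by (fastforce simp: mem_boundary_iff power2_eq_1_iff)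
  then have "inner2 (inward_normal l (x, y)) (x' - x, y' - y) \<ge> 0 \<and>
    (inner2 (inward_normal l (x, y)) (x' - x, y' - y) = 0 \<longrightarrow>
      x' = x \<and> y' = y \<or> 0 \<le> x \<and> x \<le> l \<and> y' = y \<and> (y = -1 \<or> y = 1))"
  proof cases
    case 1
    then have "inner2 (inward_normal l (x, y)) (x' - x, y' - y) = 1 - (x * x' + y * y')"
      by (simp add: inner2_def inward_normal_def power2_eq_square algebra_simps)
    then show ?thesis
      using support_left[of l x y x' y'] 1 assms by auto
  next
    case 2
    then have "inner2 (inward_normal l (x, y)) (x' - x, y' - y)
        = 1 - ((l - x) * (l - x') + y * y')"
      using assms(1) by (simp add: inner2_def inward_normal_def power2_eq_square algebra_simps)
    then show ?thesis
      using support_left[of l "l - x" y "l - x'" y'] 2 assms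
      by (auto simp: mirror_boundary power2_commute)
  next
    case 3
    then have "inner2 (inward_normal l (x, y)) (x' - x, y' - y) = 1 - y * y'"
      by (auto simp: inner2_def inward_normal_def)
    then show ?thesis
      using abs_snd_boundary_le[OF assms(3)] 3 by auto
  qed
  then show "inner2 (inward_normal l (x, y)) (x' - x, y' - y) \<ge> 0"
    "inner2 (inward_normal l (x, y)) (x' - x, y' - y) = 0 \<Longrightarrow>
      x' = x \<and> y' = y \<or> 0 \<le> x \<and> x \<le> l \<and> y' = y \<and> (y = -1 \<or> y = 1)"
    by auto
qed

text \<open>At an intermediate boundary point the two ends of the chord lie in opposite directions,
  yet both on the inner side of the tangent. The chord is then tangent there, which is only possible
  along a flat side.\<close>

lemma first_hit_chord:
  assumes "0 < l" "0 < t" "q \<in> stadium_boundary l" "ray q v t \<in> stadium_boundary l" "v \<noteq> (0, 0)"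
    and flat: "\<not> (snd q = snd (ray q v t) \<and> \<bar>snd q\<bar> = 1)"
  shows "first_hit l q v t"
  unfolding first_hit_def
proof (intro conjI allI impI)
  fix s assume s: "0 < s \<and> s < t"
  show "ray q v s \<notin> stadium_boundary l"
  proof
    assume p: "ray q v s \<in> stadium_boundary l"
    obtain x y where q: "q = (x, y)" by fastforce
    obtain a b where v: "v = (a, b)" by fastforce
    define n where "n = inward_normal l (ray q v s)"
    have ge: "inner2 n (x - (x + s * a), y - (y + s * b)) \<ge> 0"
      "inner2 n (x + t * a - (x + s * a), y + t * b - (y + s * b)) \<ge> 0"
      using inner_normal_ge(1)[of l "x + s * a" "y + s * b" x y]
        inner_normal_ge(1)[of l "x + s * a" "y + s * b" "x + t * a" "y + t * b"] assms p
      by (simp_all add: n_def q v ray_def)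
    have eq: "inner2 n (x - (x + s * a), y - (y + s * b)) = - s * inner2 n v"
      "inner2 n (x + t * a - (x + s * a), y + t * b - (y + s * b)) = (t - s) * inner2 n v"
      by (simp_all add: inner2_def v algebra_simps)
    with ge s have "inner2 n v = 0"
      by (simp add: zero_le_mult_iff mult_le_0_iff)
    with eq have "inner2 n (x - (x + s * a), y - (y + s * b)) = 0"
      by simp
    then have "b = 0 \<and> \<bar>y\<bar> = 1"
      using inner_normal_ge(2)[of l "x + s * a" "y + s * b" x y] p assms s
      by (auto simp: n_def q v ray_def)
    then show False
      using flat by (simp add: q v ray_def)
  qed
qed (use assms in auto)

lemma first_hit_unique: "first_hit l q v s \<Longrightarrow> first_hit l q v t \<Longrightarrow> s = t"
  unfolding first_hit_def by (meson linorder_neqE)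

text \<open>The cross product and the inner product of two unit vectors are the sine and the cosine
  of the angle between them; the sign condition selects the branch on which \<open>arcsin\<close>
  recovers this angle.\<close>

lemma rot_arcsin:
  assumes "(fst n)\<^sup>2 + (snd n)\<^sup>2 = 1" "(fst v)\<^sup>2 + (snd v)\<^sup>2 = 1" "inner2 n v \<ge> 0"
  shows "rot (arcsin (fst n * snd v - snd n * fst v)) n = v"
proof -
  define c where "c = fst n * snd v - snd n * fst v"
  have sq: "c\<^sup>2 + (inner2 n v)\<^sup>2 = ((fst n)\<^sup>2 + (snd n)\<^sup>2) * ((fst v)\<^sup>2 + (snd v)\<^sup>2)"
    by (simp add: c_def inner2_def power2_eq_square algebra_simps)
  then have sq1: "c\<^sup>2 + (inner2 n v)\<^sup>2 = 1"
    using assms by simp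
  then have "c\<^sup>2 \<le> 1"
    using zero_le_power2[of "inner2 n v"] by linarith
  then have c: "- 1 \<le> c" "c \<le> 1"
    by (auto simp: abs_square_le_1)
  have "cos (arcsin c) = inner2 n v"
    using c sq1 assms(3) by (simp add: cos_arcsin real_sqrt_unique algebra_simps)
  then have "rot (arcsin c) n = (inner2 n v * fst n - c * snd n, c * fst n + inner2 n v * snd n)"
    using c by (simp add: rot_def)
  also have "inner2 n v * fst n - c * snd n = ((fst n)\<^sup>2 + (snd n)\<^sup>2) * fst v"
    by (simp add: c_def inner2_def power2_eq_square algebra_simps)
  also have "c * fst n + inner2 n v * snd n = ((fst n)\<^sup>2 + (snd n)\<^sup>2) * snd v"
    by (simp add: c_def inner2_def power2_eq_square algebra_simps)
  finally show ?thesis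
    using assms(1) by (simp add: c_def)
qed

section \<open>One step of the billiard map in terms of velocity vectors\<close>

definition velocity :: "real \<Rightarrow> (real \<times> real) \<times> real \<Rightarrow> real \<times> real" where
  "velocity l x = rot (snd x) (inward_normal l (fst x))"

text \<open>Inverse to \<open>velocity\<close> for unit vectors pointing inward. Orbits are computed
  with velocity vectors, and angles appear only through this conversion.\<close>

definition phase_point :: "real \<Rightarrow> real \<times> real \<Rightarrow> real \<times> real \<Rightarrow> (real \<times> real) \<times> real" where
  "phase_point l q v = (q, arcsin (fst (inward_normal l q) * snd v - snd (inward_normal l q) * fst v))"

lemma cross_bounded:
  fixes n v :: "real \<times> real"
  assumes "(fst n)\<^sup>2 + (snd n)\<^sup>2 = 1" "(fst v)\<^sup>2 + (snd v)\<^sup>2 = 1"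
  shows "\<bar>fst n * snd v - snd n * fst v\<bar> \<le> 1"
proof -
  have "(fst n * snd v - snd n * fst v)\<^sup>2 + (inner2 n v)\<^sup>2
      = ((fst n)\<^sup>2 + (snd n)\<^sup>2) * ((fst v)\<^sup>2 + (snd v)\<^sup>2)"
    by (simp add: inner2_def power2_eq_square algebra_simps)
  then have "(fst n * snd v - snd n * fst v)\<^sup>2 + (inner2 n v)\<^sup>2 = 1"
    using assms by simp
  then have "(fst n * snd v - snd n * fst v)\<^sup>2 \<le> 1"
    using zero_le_power2[of "inner2 n v"] by linarith
  then show ?thesis
    by (simp add: abs_square_le_1)
qed

text \<open>The criterion by which constructed orbits are verified: by convexity it suffices that
  both ends of the chord lie on the boundary and not on the same flat side.\<close>

lemma billiard_map_phase_point:
  assumes "0 < l" "0 < t" "q \<in> stadium_boundary l" "ray q v t \<in> stadium_boundary l"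
    and v: "(fst v)\<^sup>2 + (snd v)\<^sup>2 = 1"
    and flat: "\<not> (snd q = snd (ray q v t) \<and> \<bar>snd q\<bar> = 1)"
  shows "billiard_map l (phase_point l q v)
    = Some (phase_point l (ray q v t) (reflect v (inward_normal l (ray q v t))))"
proof -
  define n where "n = inward_normal l q"
  have n: "(fst n)\<^sup>2 + (snd n)\<^sup>2 = 1"
    using norm_inward_normal assms by (simp add: n_def)
  have "inner2 n (fst (ray q v t) - fst q, snd (ray q v t) - snd q) \<ge> 0"
    using inner_normal_ge(1)[of l "fst q" "snd q" "fst (ray q v t)" "snd (ray q v t)"] assms
    by (simp add: n_def)
  then have "t * inner2 n v \<ge> 0"
    by (simp add: inner2_def ray_def algebra_simps)
  then have "inner2 n v \<ge> 0"
    using \<open>0 < t\<close> by (simp add: zero_le_mult_iff)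
  then have rot: "rot (arcsin (fst n * snd v - snd n * fst v)) n = v"
    using rot_arcsin n v by blast
  have hit: "first_hit l q v t"
    using first_hit_chord assms by fastforce
  then have the: "(THE t. first_hit l q v t) = t"
    using first_hit_unique by blast
  have "phase_point l q v \<in> phase_space l"
    using assms(3) cross_bounded[OF n v] arcsin_bounded[of "fst n * snd v - snd n * fst v"]
    by (auto simp: phase_space_def phase_point_def n_def)
  then show ?thesis
    using hit rot the by (auto simp: billiard_map_def phase_point_def n_def Let_def)
qed

lemma norm_rot: "(fst (rot phi n))\<^sup>2 + (snd (rot phi n))\<^sup>2 = (fst n)\<^sup>2 + (snd n)\<^sup>2"
proof -
  have "(fst (rot phi n))\<^sup>2 + (snd (rot phi n))\<^sup>2
      = ((sin phi)\<^sup>2 + (cos phi)\<^sup>2) * ((fst n)\<^sup>2 + (snd n)\<^sup>2)"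
    unfolding rot_def fst_conv snd_conv by algebra
  then show ?thesis by simp
qed

lemma norm_reflect:
  assumes "(fst n)\<^sup>2 + (snd n)\<^sup>2 = 1"
  shows "(fst (reflect v n))\<^sup>2 + (snd (reflect v n))\<^sup>2 = (fst v)\<^sup>2 + (snd v)\<^sup>2"
  using assms unfolding reflect_def Let_def fst_conv snd_conv by algebra

lemma reflect_reflect:
  assumes "(fst n)\<^sup>2 + (snd n)\<^sup>2 = 1"
  shows "reflect (reflect v n) n = v"
  using assms by (intro prod_eqI; unfold reflect_def Let_def fst_conv snd_conv) algebra+

lemma inner2_reflect:
  assumes "(fst n)\<^sup>2 + (snd n)\<^sup>2 = 1"
  shows "inner2 n (reflect v n) = - inner2 n v"
  using assms unfolding inner2_def reflect_def Let_def fst_conv snd_conv by algebra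

text \<open>By convexity the incoming velocity does not point inward at the new collision point, so
  the reflected one does not point outward. Hence \<open>arcsin\<close> loses no information, and
  \<open>velocity l z\<close> is exactly the reflected vector.\<close>

lemma billiard_mapE:
  assumes "billiard_map l x = Some z" "0 < l"
  obtains t where "x \<in> phase_space l" "first_hit l (fst x) (velocity l x) t"
    "fst z = ray (fst x) (velocity l x) t"
    "velocity l z = reflect (velocity l x) (inward_normal l (fst z))"
    "snd z = snd (phase_point l (fst z) (velocity l z))"
    "(fst (velocity l x))\<^sup>2 + (snd (velocity l x))\<^sup>2 = 1"
proof -
  define v where "v = velocity l x"
  have x: "x \<in> phase_space l" and ex: "\<exists>t. first_hit l (fst x) v t"
    using assms(1) by (auto simp: billiard_map_def v_def velocity_def Let_def split: if_splits)
  then obtain t where t: "first_hit l (fst x) v t" by blast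
  then have the: "(THE t. first_hit l (fst x) v t) = t"
    using first_hit_unique by blast
  define q where "q = ray (fst x) v t"
  define v' where "v' = reflect v (inward_normal l q)"
  have z: "z = phase_point l q v'"
    using assms(1) x ex the
    by (auto simp: billiard_map_def v_def velocity_def Let_def phase_point_def q_def v'_def split: if_splits)
  have bd: "fst x \<in> stadium_boundary l" "q \<in> stadium_boundary l"
    using x t by (auto simp: phase_space_def first_hit_def q_def)
  have v: "(fst v)\<^sup>2 + (snd v)\<^sup>2 = 1"
    using norm_inward_normal bd assms by (simp add: v_def velocity_def norm_rot)
  have n: "(fst (inward_normal l q))\<^sup>2 + (snd (inward_normal l q))\<^sup>2 = 1"
    using norm_inward_normal bd assms by simp
  have "inner2 (inward_normal l q) (fst (fst x) - fst q, snd (fst x) - snd q) \<ge> 0"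
    using inner_normal_ge(1)[of l "fst q" "snd q" "fst (fst x)" "snd (fst x)"] assms bd by simp
  then have "t * inner2 (inward_normal l q) v \<le> 0"
    by (simp add: inner2_def ray_def q_def algebra_simps)
  then have "inner2 (inward_normal l q) v \<le> 0"
    using t by (simp add: first_hit_def mult_le_0_iff)
  then have "velocity l z = v'"
    using rot_arcsin[of "inward_normal l q" v'] n v
    by (simp add: z phase_point_def velocity_def v'_def norm_reflect inner2_reflect)
  then show thesis
    using x t v that[of t] by (simp add: z phase_point_def v_def q_def v'_def)
qed

section \<open>Injectivity of the map and uniqueness of orbits\<close>

lemma velocity_inj:
  assumes "x \<in> phase_space l" "y \<in> phase_space l" "fst x = fst y" "velocity l x = velocity l y" "0 < l"
  shows "x = y"
proof -
  define n where "n = inward_normal l (fst x)"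
  have n: "(fst n)\<^sup>2 + (snd n)\<^sup>2 = 1"
    using norm_inward_normal assms by (auto simp: n_def phase_space_def)
  have "fst n * snd (rot phi n) - snd n * fst (rot phi n) = sin phi" for phi
  proof -
    have "fst n * snd (rot phi n) - snd n * fst (rot phi n) = sin phi * ((fst n)\<^sup>2 + (snd n)\<^sup>2)"
      unfolding rot_def fst_conv snd_conv by algebra
    then show ?thesis
      using n by simp
  qed
  then have "sin (snd x) = sin (snd y)"
    using assms by (metis n_def velocity_def)
  then have "snd x = snd y"
    using sin_inj_pi[of "snd x" "snd y"] assms(1,2) by (auto simp: phase_space_def)
  then show ?thesis
    using assms by (simp add: prod_eq_iff)
qed

text \<open>The previous collision is the first boundary point behind the current one.\<close>

lemma billiard_map_inj:
  assumes "billiard_map l x = Some z" "billiard_map l y = Some z" "0 < l"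
  shows "x = y"
proof -
  obtain s where s: "x \<in> phase_space l" "first_hit l (fst x) (velocity l x) s"
    "fst z = ray (fst x) (velocity l x) s"
    "velocity l z = reflect (velocity l x) (inward_normal l (fst z))"
    using billiard_mapE[OF assms(1,3)] by metis
  obtain t where t: "y \<in> phase_space l" "first_hit l (fst y) (velocity l y) t"
    "fst z = ray (fst y) (velocity l y) t"
    "velocity l z = reflect (velocity l y) (inward_normal l (fst z))"
    using billiard_mapE[OF assms(2,3)] by metis
  have n: "(fst (inward_normal l (fst z)))\<^sup>2 + (snd (inward_normal l (fst z)))\<^sup>2 = 1"
    using norm_inward_normal s assms by (auto simp: first_hit_def)
  have v: "velocity l x = velocity l y"
    by (metis s(4) t(4) reflect_reflect[OF n])
  have bd: "fst x \<in> stadium_boundary l" "fst y \<in> stadium_boundary l"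
    using s t by (auto simp: phase_space_def)
  have "ray (fst x) (velocity l x) (s - t) = fst y" "ray (fst y) (velocity l y) (t - s) = fst x"
    using s(3) t(3) v by (simp_all add: ray_def prod_eq_iff left_diff_distrib)
  moreover have "0 < s" "0 < t"
    using s t by (auto simp: first_hit_def)
  ultimately have "s = t"
    using s(2) t(2) bd unfolding first_hit_def
    by (smt (verit, best))
  then have "fst x = fst y"
    using s(3) t(3) v by (auto simp: ray_def prod_eq_iff)
  then show ?thesis
    using velocity_inj s t v assms by blast
qed

text \<open>Membership in K and having an itinerary are witnessed by orbits of the same point, which
  have to be identified in the past as well.\<close>

lemma full_orbit_unique:
  assumes "full_orbit l x xs" "full_orbit l x ys" "0 < l"
  shows "xs = ys"
proof
  fix n :: int
  show "xs n = ys n"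
  proof (induction n rule: int_induct[where k = 0])
    case base
    then show ?case using assms by (simp add: full_orbit_def)
  next
    case (step1 i)
    then show ?case using assms unfolding full_orbit_def by (metis option.inject)
  next
    case (step2 i)
    have "billiard_map l (xs (i - 1)) = Some (xs i)" "billiard_map l (ys (i - 1)) = Some (ys i)"
      using assms unfolding full_orbit_def by (metis diff_add_cancel)+
    then show ?case
      using billiard_map_inj step2 assms by metis
  qed
qed

section \<open>Motion between two visits to the semicircles\<close>

lemma no_repeated_flat_side:
  assumes "billiard_map l x = Some z" "0 < l" "s = T \<or> s = B" "fst x \<in> piece l s"
  shows "fst z \<notin> piece l s"
proof
  assume z: "fst z \<in> piece l s"
  obtain t where t: "first_hit l (fst x) (velocity l x) t" "fst z = ray (fst x) (velocity l x) t"
    using billiard_mapE[OF assms(1,2)] by metis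
  then have "0 < t"
    by (simp add: first_hit_def)
  define a where "a = fst (velocity l x)"
  have pos: "0 \<le> fst (fst x)" "fst (fst x) \<le> l" "0 \<le> fst (fst x) + t * a" "fst (fst x) + t * a \<le> l"
    "\<bar>snd (fst x)\<bar> = 1" "snd (velocity l x) = 0"
    using z assms(3,4) t(2) \<open>0 < t\<close> by (auto simp: piece_def ray_def a_def)
  \<comment> \<open>The midpoint of such a flight lies on the same flat side, so the flight would
    have ended earlier.\<close>
  have "ray (fst x) (velocity l x) (t / 2) \<in> stadium_boundary l"
    using pos by (auto simp: ray_def mem_boundary_iff a_def[symmetric])
  then show False
    using t(1) \<open>0 < t\<close> by (auto simp: first_hit_def dest: spec[of _ "t / 2"])
qed

lemma horizontal_velocity_flat:
  assumes "billiard_map l x = Some z" "0 < l" "fst z \<in> piece l T \<or> fst z \<in> piece l B"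
  shows "fst (velocity l z) = fst (velocity l x)"
proof -
  have "velocity l z = reflect (velocity l x) (inward_normal l (fst z))"
    using billiard_mapE[OF assms(1,2)] by metis
  moreover have "fst (inward_normal l (fst z)) = 0"
    using assms(3) by (auto simp: piece_def inward_normal_def)
  ultimately show ?thesis
    by (simp add: reflect_def)
qed

lemma horizontal_step:
  assumes "billiard_map l x = Some z" "0 < l"
  shows "sgn (fst (fst z) - fst (fst x)) = sgn (fst (velocity l x))"
proof -
  obtain t where "first_hit l (fst x) (velocity l x) t" "fst z = ray (fst x) (velocity l x) t"
    using billiard_mapE[OF assms] by metis
  then show ?thesis
    by (simp add: ray_def first_hit_def sgn_mult)
qed

lemma mem_boundary_left: "q \<in> stadium_boundary l \<Longrightarrow> fst q \<le> 0 \<Longrightarrow> 0 < l \<Longrightarrow> q \<in> piece l L"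
  by (cases q) (auto simp: mem_boundary_iff piece_def)

lemma mem_boundary_right: "q \<in> stadium_boundary l \<Longrightarrow> l \<le> fst q \<Longrightarrow> 0 < l \<Longrightarrow> q \<in> piece l R"
  by (cases q) (auto simp: mem_boundary_iff piece_def)

text \<open>After a collision with \<open>L\<close> the next point is not on \<open>L\<close>, so
  its abscissa is positive and the ball moves right. Flat collisions preserve the horizontal
  velocity, so the abscissa stays positive up to time \<open>b\<close>. Comparison starts at
  \<open>a + 1\<close> because there the inequality is strict.\<close>

lemma semicircles_alternate:
  fixes xs :: "int \<Rightarrow> (real \<times> real) \<times> real"
  assumes "0 < l" and step: "\<And>n. billiard_map l (xs n) = Some (xs (n + 1))"
    and K: "\<And>n. \<not> (fst (xs n) \<in> piece l L \<and> fst (xs (n + 1)) \<in> piece l L)"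
      "\<And>n. \<not> (fst (xs n) \<in> piece l R \<and> fst (xs (n + 1)) \<in> piece l R)"
    and "a < b" and flat: "\<And>i. a < i \<Longrightarrow> i < b \<Longrightarrow> fst (xs i) \<in> piece l T \<or> fst (xs i) \<in> piece l B"
  shows "fst (xs a) \<in> piece l L \<Longrightarrow> fst (xs b) \<notin> piece l L"
    and "fst (xs a) \<in> piece l R \<Longrightarrow> fst (xs b) \<notin> piece l R"
proof -
  define X where "X n = fst (fst (xs n))" for n
  define V where "V n = fst (velocity l (xs n))" for n
  have bd: "fst (xs n) \<in> stadium_boundary l" for n
  proof -
    have "xs n \<in> phase_space l"
      using billiard_mapE[OF step[of n] assms(1)] by metis
    then show ?thesis
      by (auto simp: phase_space_def)
  qed
  have V: "sgn (X (n + 1) - X n) = sgn (V n)" for n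
    using horizontal_step[OF step assms(1)] by (simp add: X_def V_def)
  have run: "V i = V a \<and> sgn (X (i + 1) - X i) = sgn (V a)" if "a \<le> i" "i < b" for i
    using that
  proof (induction i rule: int_ge_induct)
    case (step i)
    then have "V (i + 1) = V i"
      using flat[of "i + 1"] horizontal_velocity_flat[OF assms(2) assms(1)] by (simp add: V_def)
    then show ?case
      using step V[of "i + 1"] by simp
  qed (simp add: V)
  have "b - 1 \<ge> a"
    using \<open>a < b\<close> by simp
  have up: "X (a + 1) \<le> X (i + 1)" if "V a > 0" "a \<le> i" "i < b" for i
    using that(2,3)
  proof (induction i rule: int_ge_induct)
    case (step i)
    then show ?case
      using run[of "i + 1"] that(1) by (simp add: sgn_if split: if_splits)
  qed simp
  have down: "X (a + 1) \<ge> X (i + 1)" if "V a < 0" "a \<le> i" "i < b" for i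
    using that(2,3)
  proof (induction i rule: int_ge_induct)
    case (step i)
    then show ?case
      using run[of "i + 1"] that(1) by (simp add: sgn_if split: if_splits)
  qed simp
  show "fst (xs b) \<notin> piece l L" if "fst (xs a) \<in> piece l L"
  proof -
    have "X a \<le> 0"
      using that by (auto simp: X_def piece_def)
    moreover have "X (a + 1) > 0"
      using that K(1)[of a] mem_boundary_left[OF bd[of "a + 1"] _ assms(1)] by (force simp: X_def)
    ultimately have "X b > 0"
      using up[of "b - 1"] V[of a] \<open>a < b\<close> by (simp add: sgn_if split: if_splits)
    then show ?thesis
      by (auto simp: X_def piece_def)
  qed
  show "fst (xs b) \<notin> piece l R" if "fst (xs a) \<in> piece l R"
  proof -
    have "X a \<ge> l"
      using that by (auto simp: X_def piece_def)
    moreover have "X (a + 1) < l"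
      using that K(2)[of a] mem_boundary_right[OF bd[of "a + 1"] _ assms(1)] by (force simp: X_def)
    ultimately have "X b < l"
      using down[of "b - 1"] V[of a] \<open>a < b\<close> by (simp add: sgn_if split: if_splits)
    then show ?thesis
      by (auto simp: X_def piece_def)
  qed
qed

section \<open>Angles solving the law of reflection\<close>

text \<open>Banach's fixed point theorem for the supremum distance on a box. A uniform bound
  \<open>d\<close> replaces the distance, so only real sequences, one for each coordinate, have to
  converge.\<close>

lemma contraction_fixed_point:
  fixes F :: "('i \<Rightarrow> real) \<Rightarrow> 'i \<Rightarrow> real"
  assumes box: "\<And>x i. (\<And>j. \<bar>x j\<bar> \<le> r) \<Longrightarrow> \<bar>F x i\<bar> \<le> r"
    and contr: "\<And>x y d i. (\<And>j. \<bar>x j\<bar> \<le> r) \<Longrightarrow> (\<And>j. \<bar>y j\<bar> \<le> r) \<Longrightarrow>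
      (\<And>j. \<bar>x j - y j\<bar> \<le> d) \<Longrightarrow> \<bar>F x i - F y i\<bar> \<le> d / 2"
    and r: "0 \<le> r"
  shows "\<exists>x. (\<forall>i. \<bar>x i\<bar> \<le> r) \<and> (\<forall>i. F x i = x i)"
proof -
  define X where "X n = (F ^^ n) (\<lambda>_. 0)" for n
  have X_box: "\<bar>X n i\<bar> \<le> r" for n i
    by (induction n arbitrary: i) (auto simp: X_def r intro: box)
  have X_diff: "\<bar>X (n + k) i - X n i\<bar> \<le> 2 * r / 2 ^ n" for n k i
  proof (induction n arbitrary: i)
    case 0
    then show ?case
      using X_box[of k i] X_box[of 0 i] by simp
  next
    case (Suc n)
    show ?case
      using contr[OF X_box X_box Suc, where i = i] by (simp add: X_def field_simps)
  qed
  have small: "(\<lambda>n. 2 * r / 2 ^ n) \<longlonglongrightarrow> 0"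
    using LIMSEQ_divide_realpow_zero[of 2 "2 * r"] by simp
  have "convergent (\<lambda>n. X n i)" for i
  proof (rule Cauchy_convergent, rule CauchyI')
    fix e :: real assume "0 < e"
    then obtain M where M: "2 * r / 2 ^ M < e / 2"
      using order_tendstoD(2)[OF small, of "e / 2"] by (auto simp: eventually_sequentially)
    show "\<exists>M. \<forall>m\<ge>M. \<forall>n>m. dist (X m i) (X n i) < e"
    proof (intro exI allI impI)
      fix m n assume "M \<le> m" "m < n"
      then have "\<bar>X m i - X M i\<bar> \<le> 2 * r / 2 ^ M" "\<bar>X n i - X M i\<bar> \<le> 2 * r / 2 ^ M"
        using X_diff[of M "m - M" i] X_diff[of M "n - M" i] by auto
      then show "dist (X m i) (X n i) < e"
        using M by (simp add: dist_real_def)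
    qed
  qed
  then obtain y where y: "(\<lambda>n. X n i) \<longlonglongrightarrow> y i" for i
    unfolding convergent_def by metis
  have y_box: "\<bar>y i\<bar> \<le> r" for i
    using tendsto_rabs[OF y[of i]] X_box by (intro LIMSEQ_le_const2) auto
  \<comment> \<open>Coordinatewise convergence would not suffice to pass to the limit in
    \<open>F\<close>; this bound is uniform in \<open>i\<close>, so \<open>contr\<close> applies to
    \<open>y\<close> and \<open>X n\<close>.\<close>
  have y_diff: "\<bar>y i - X n i\<bar> \<le> 2 * r / 2 ^ n" for n i
  proof (rule LIMSEQ_le_const2)
    show "(\<lambda>k. \<bar>X (k + n) i - X n i\<bar>) \<longlonglongrightarrow> \<bar>y i - X n i\<bar>"
      using LIMSEQ_ignore_initial_segment[OF y[of i], of n] by (intro tendsto_intros)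
    show "\<exists>N. \<forall>k\<ge>N. \<bar>X (k + n) i - X n i\<bar> \<le> 2 * r / 2 ^ n"
      using X_diff[of n _ i] by (simp add: add.commute)
  qed
  have "F y i = y i" for i
  proof (rule LIMSEQ_unique)
    have "\<bar>X (Suc n) i - F y i\<bar> \<le> 2 * r / 2 ^ n / 2" for n
      using contr[OF X_box y_box, where i = i and d = "2 * r / 2 ^ n"] y_diff[of _ n]
      by (simp add: X_def abs_minus_commute)
    moreover have "2 * r / 2 ^ n / 2 \<le> 2 * r / 2 ^ n" for n
      using r by (simp add: divide_right_mono)
    ultimately have "\<bar>X (Suc n) i - F y i\<bar> \<le> 2 * r / 2 ^ n" for n
      by (rule order_trans)
    then have "(\<lambda>n. X (Suc n) i - F y i) \<longlonglongrightarrow> 0"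
      by (intro tendsto_rabs_zero_cancel[OF tendsto_sandwich[OF _ _ tendsto_const small]]) auto
    then show "(\<lambda>n. X (Suc n) i) \<longlonglongrightarrow> F y i"
      by (simp add: LIM_zero_iff)
    show "(\<lambda>n. X (Suc n) i) \<longlonglongrightarrow> y i"
      by (rule LIMSEQ_Suc[OF y])
  qed
  with y_box show ?thesis by blast
qed

section \<open>Bounds for the slopes of chords\<close>

lemma lipschitz_of_deriv_le_1:
  fixes f :: "real \<Rightarrow> real"
  assumes deriv: "\<And>x. (f has_real_derivative f' x) (at x)" and bound: "\<And>x. \<bar>f' x\<bar> \<le> 1"
  shows "\<bar>f a - f b\<bar> \<le> \<bar>a - b\<bar>"
proof -
  have *: "\<bar>f y - f x\<bar> \<le> \<bar>y - x\<bar>" if "x < y" for x y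
  proof -
    obtain z where "f y - f x = (y - x) * f' z"
      using MVT2[OF \<open>x < y\<close>, of f f'] deriv by blast
    then show ?thesis
      using bound[of z] by (simp add: abs_mult mult_left_le)
  qed
  show ?thesis
    using *[of a b] *[of b a] by (cases a b rule: linorder_cases) (auto simp: abs_minus_commute)
qed

lemma abs_sin_diff_le: "\<bar>sin a - sin b\<bar> \<le> \<bar>a - b :: real\<bar>"
  by (rule lipschitz_of_deriv_le_1[where f' = cos]) (auto intro!: derivative_eq_intros)

lemma abs_cos_diff_le: "\<bar>cos a - cos b\<bar> \<le> \<bar>a - b :: real\<bar>"
  by (rule lipschitz_of_deriv_le_1[where f' = "\<lambda>x. - sin x"]) (auto intro!: derivative_eq_intros)

lemma abs_arctan_diff_le: "\<bar>arctan a - arctan b\<bar> \<le> \<bar>a - b\<bar>"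
proof (rule lipschitz_of_deriv_le_1[where f' = "\<lambda>x. inverse (1 + x\<^sup>2)"])
  show "\<bar>inverse (1 + x\<^sup>2)\<bar> \<le> 1" for x :: real
    by (simp add: add_pos_nonneg field_simps)
qed (rule DERIV_arctan)

lemma abs_arctan_le_abs: "\<bar>arctan a\<bar> \<le> \<bar>a\<bar>"
  using abs_arctan_diff_le[of a 0] by simp

text \<open>A chord with K flat collisions from the left semicircle, at angle a above the horizontal
  axis, to the right one, at angle b, becomes a straight segment after unfolding the strip;
  e is 1 or -1 according to whether the first flat collision is on the top or on the bottom.
  The same formula serves chords from right to left, by mirror symmetry.\<close>

definition slope :: "real \<Rightarrow> real \<Rightarrow> nat \<Rightarrow> real \<Rightarrow> real \<Rightarrow> real" where
  "slope l e K a b = (2 * e * real K + (-1) ^ K * sin b - sin a) / (l + cos a + cos b)"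

lemma cos_quarter:
  fixes a :: real
  assumes "\<bar>a\<bar> \<le> 1 / 4"
  shows "cos a > 0" "\<bar>sin a\<bar> \<le> 1 / 4"
proof -
  show "cos a > 0"
    using assms pi_ge_two by (intro cos_gt_zero_pi) auto
  show "\<bar>sin a\<bar> \<le> 1 / 4"
    using abs_sin_diff_le[of a 0] assms by simp
qed

text \<open>The numerator is at most 2 N + 1/2 and the denominator exceeds 16 (N + 1). Since
  \<open>arctan\<close> does not increase absolute values, the box of angles up to 1/4 becomes
  invariant.\<close>

lemma abs_slope_le:
  assumes "\<bar>a\<bar> \<le> 1 / 4" "\<bar>b\<bar> \<le> 1 / 4" "\<bar>e\<bar> = 1" "K \<le> N" "l \<ge> 16 * (real N + 1)"
  shows "\<bar>slope l e K a b\<bar> \<le> 1 / 4"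
proof -
  define n D where "n = 2 * e * real K + (-1) ^ K * sin b - sin a" "D = l + cos a + cos b"
  have "\<bar>n\<bar> \<le> \<bar>2 * e * real K\<bar> + \<bar>(-1) ^ K * sin b\<bar> + \<bar>sin a\<bar>"
    unfolding n_D_def by linarith
  also have "\<dots> \<le> 2 * real N + 1 / 4 + 1 / 4"
    using cos_quarter(2)[OF assms(1)] cos_quarter(2)[OF assms(2)] assms(3,4)
    by (simp add: abs_mult power_abs)
  finally have "4 * \<bar>n\<bar> \<le> D"
    using cos_quarter(1)[OF assms(1)] cos_quarter(1)[OF assms(2)] assms(5) by (simp add: n_D_def)
  moreover have "D > 0"
    using cos_quarter(1)[OF assms(1)] cos_quarter(1)[OF assms(2)] assms(5) by (simp add: n_D_def)
  ultimately show ?thesis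
    unfolding slope_def n_D_def[symmetric] by (simp add: field_simps)
qed

text \<open>Writing the difference of quotients as ((n - n') - S (D - D')) / D leaves a single
  denominator. The numerator is at most 2 d + d / 2, bounded generously by 4 d, and D is at least
  16.\<close>

lemma slope_lipschitz:
  assumes "\<bar>a\<bar> \<le> 1 / 4" "\<bar>b\<bar> \<le> 1 / 4" "\<bar>a'\<bar> \<le> 1 / 4" "\<bar>b'\<bar> \<le> 1 / 4"
    and "\<bar>e\<bar> = 1" "K \<le> N" "l \<ge> 16 * (real N + 1)" "\<bar>a - a'\<bar> \<le> d" "\<bar>b - b'\<bar> \<le> d"
  shows "\<bar>slope l e K a b - slope l e K a' b'\<bar> \<le> d / 2"
proof -
  define n D where "n = 2 * e * real K + (-1) ^ K * sin b - sin a" "D = l + cos a + cos b"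
  define n' D' where "n' = 2 * e * real K + (-1) ^ K * sin b' - sin a'" "D' = l + cos a' + cos b'"
  define S where "S = slope l e K a' b'"
  have D: "D \<ge> 16" "D' > 0"
    using cos_quarter(1)[OF assms(1)] cos_quarter(1)[OF assms(2)] cos_quarter(1)[OF assms(3)]
      cos_quarter(1)[OF assms(4)] assms(7) by (simp_all add: n_D_def n'_D'_def)
  have S: "\<bar>S\<bar> \<le> 1 / 4"
    using abs_slope_le[of a' b' e K N l] assms by (simp add: S_def)
  have "n - n' = (-1) ^ K * (sin b - sin b') - (sin a - sin a')"
    by (simp add: n_D_def n'_D'_def algebra_simps)
  then have "\<bar>n - n'\<bar> \<le> \<bar>(-1) ^ K * (sin b - sin b')\<bar> + \<bar>sin a - sin a'\<bar>"
    by linarith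
  also have "\<dots> \<le> 2 * d"
    using abs_sin_diff_le[of a a'] abs_sin_diff_le[of b b'] assms(8,9) by (simp add: abs_mult power_abs)
  finally have nn: "\<bar>n - n'\<bar> \<le> 2 * d" .
  have "\<bar>D - D'\<bar> \<le> 2 * d"
    using abs_cos_diff_le[of a a'] abs_cos_diff_le[of b b'] assms(8,9) by (simp add: n_D_def n'_D'_def)
  then have "\<bar>S\<bar> * \<bar>D - D'\<bar> \<le> (1 / 4) * (2 * d)"
    using S by (intro mult_mono) auto
  then have "\<bar>(n - n') - S * (D - D')\<bar> \<le> 4 * d"
    using nn by (simp add: abs_mult[symmetric])
  moreover have "slope l e K a b - S = ((n - n') - S * (D - D')) / D"
  proof -
    have "slope l e K a b = n / D" "S = n' / D'"
      by (simp_all add: S_def slope_def n_D_def n'_D'_def)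
    then show ?thesis
      using D by (simp add: field_simps)
  qed
  moreover have "d \<ge> 0"
    using assms(8) by linarith
  moreover have "16 * d \<le> D * d"
    using D \<open>d \<ge> 0\<close> by (intro mult_right_mono) auto
  ultimately show ?thesis
    using D unfolding S_def[symmetric] by (simp add: pos_divide_le_eq abs_divide mult.commute)
qed

text \<open>Time reversal: after K flat collisions the chord arrives with slope (-1)^K times the
  initial one, and traversing it backwards in the mirrored table changes the sign. The first flat
  collision of the reversed chord is the last one of the original, which gives
  \<open>e'\<close>.\<close>

lemma slope_reverse:
  assumes "K > 0 \<Longrightarrow> e' = - e * (-1) ^ K"
  shows "slope l e' K b a = - ((-1) ^ K * slope l e K a b)"
proof -
  define s where "s = (-1 :: real) ^ K"
  have sq: "s * s = 1"
    by (simp add: s_def flip: power_add)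
  have "2 * e' * real K = 2 * (- e * s) * real K"
    using assms by (cases "K = 0") (auto simp: s_def)
  then have num: "2 * e' * real K + s * sin a - sin b = - (s * (2 * e * real K + s * sin b - sin a))"
    using sq by algebra
  have den: "l + cos b + cos a = l + cos a + cos b"
    by simp
  show ?thesis
    unfolding slope_def s_def[symmetric] num den by simp
qed

lemma abs_half_sum_le:
  fixes x y c :: real
  assumes "\<bar>x\<bar> \<le> c" "\<bar>y\<bar> \<le> c"
  shows "\<bar>- (x + y) / 2\<bar> \<le> c"
  using assms by (auto simp: abs_le_iff)

lemma abs_half_sum_diff_le:
  fixes x y x' y' c :: real
  assumes "\<bar>x - x'\<bar> \<le> c" "\<bar>y - y'\<bar> \<le> c"
  shows "\<bar>- (x + y) / 2 - (- (x' + y') / 2)\<bar> \<le> c"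
proof -
  have *: "- (x + y) / 2 - (- (x' + y') / 2) = - ((x - x') + (y - y')) / 2"
    by (simp add: field_simps)
  show ?thesis
    unfolding * using assms by (rule abs_half_sum_le)
qed

text \<open>The normal at a collision bisects the directions to the next and to the previous
  collision. In the frame where the table lies to the right, the normal at angle
  \<open>\<theta> i\<close> has direction \<open>- \<theta> i\<close>, which must therefore be the
  mean of the two arctangents. \<open>nx\<close> and \<open>pv\<close> will point to the
  neighbouring semicircle collisions.\<close>

lemma angles_exist:
  fixes nx pv :: "'i \<Rightarrow> 'i"
  assumes "\<And>i. \<bar>e i\<bar> = 1" "\<And>i. \<bar>e' i\<bar> = 1" "\<And>i. K i \<le> N" "\<And>i. K' i \<le> N" "l \<ge> 16 * (real N + 1)"
  shows "\<exists>\<theta>. (\<forall>i. \<bar>\<theta> i\<bar> \<le> 1 / 4) \<and> (\<forall>i. - (arctan (slope l (e i) (K i) (\<theta> i) (\<theta> (nx i)))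
    + arctan (slope l (e' i) (K' i) (\<theta> i) (\<theta> (pv i)))) / 2 = \<theta> i)"
proof (rule contraction_fixed_point)
  let ?f = "\<lambda>\<theta> i. slope l (e i) (K i) (\<theta> i) (\<theta> (nx i))"
  let ?g = "\<lambda>\<theta> i. slope l (e' i) (K' i) (\<theta> i) (\<theta> (pv i))"
  show "\<bar>- (arctan (?f \<theta> i) + arctan (?g \<theta> i)) / 2\<bar> \<le> 1 / 4"
    if "\<And>j. \<bar>\<theta> j\<bar> \<le> 1 / 4" for \<theta> i
    using that assms
    by (intro abs_half_sum_le order_trans[OF abs_arctan_le_abs] abs_slope_le) auto
  show "\<bar>- (arctan (?f x i) + arctan (?g x i)) / 2 - (- (arctan (?f y i) + arctan (?g y i)) / 2)\<bar> \<le> d / 2"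
    if "\<And>j. \<bar>x j\<bar> \<le> 1 / 4" "\<And>j. \<bar>y j\<bar> \<le> 1 / 4" "\<And>j. \<bar>x j - y j\<bar> \<le> d" for x y d i
  proof -
    have "\<bar>arctan (?f x i) - arctan (?f y i)\<bar> \<le> d / 2"
      by (rule order_trans[OF abs_arctan_diff_le slope_lipschitz])
        (rule that assms)+
    moreover have "\<bar>arctan (?g x i) - arctan (?g y i)\<bar> \<le> d / 2"
      by (rule order_trans[OF abs_arctan_diff_le slope_lipschitz])
        (rule that assms)+
    ultimately show ?thesis
      by (rule abs_half_sum_diff_le)
  qed
qed simp

text \<open>The unfolded line starts at (- cos a, sin a) and meets the j-th copy of a flat side at
  height e (2 j - 1); folding back turns this height into - e (-1)^j. Indices 0 and K + 1 are the
  ends on the semicircles.\<close>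

definition bounce :: "real \<Rightarrow> real \<Rightarrow> nat \<Rightarrow> real \<Rightarrow> real \<Rightarrow> nat \<Rightarrow> real \<times> real" where
  "bounce l e K a b j =
     (if j = 0 then (- cos a, sin a)
      else if j = K + 1 then (l + cos b, sin b)
      else (- cos a + (e * (2 * real j - 1) - sin a) / slope l e K a b, - e * (-1) ^ j))"

section \<open>Geometry of a single chord\<close>

context
  fixes a b e l S :: real and K N :: nat
  assumes ab: "\<bar>a\<bar> \<le> 1 / 4" "\<bar>b\<bar> \<le> 1 / 4" and e: "e = 1 \<or> e = -1" and K: "K \<le> N"
    and l: "l \<ge> 16 * (real N + 1)"
    and S_def: "S = slope l e K a b"
begin

lemma e_sq: "e * e = 1" "\<bar>e\<bar> = 1"
  using e by auto

lemma S_bound: "\<bar>S\<bar> \<le> 1 / 4"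
  unfolding S_def using abs_slope_le[OF ab e_sq(2) K l] .

text \<open>With a flat collision the unfolded chord climbs at least 2 - 1/2 in the direction of
  \<open>e\<close>. This also justifies the division by the slope in \<open>bounce\<close>.\<close>

lemma slope_pos:
  assumes "0 < K"
  shows "0 < e * S"
proof -
  have n: "\<bar>e * ((-1) ^ K * sin b - sin a)\<bar> \<le> 1 / 2"
  proof -
    have "\<bar>(-1) ^ K * sin b\<bar> \<le> 1 / 4"
      using cos_quarter(2)[OF ab(2)] by (simp add: abs_mult power_abs)
    moreover have "\<bar>sin a\<bar> \<le> 1 / 4"
      using cos_quarter(2)[OF ab(1)] .
    ultimately have "\<bar>(-1) ^ K * sin b - sin a\<bar> \<le> 1 / 2"
      by linarith
    then show ?thesis
      using e_sq(2) by (simp add: abs_mult)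
  qed
  have "e * (2 * e * real K + (-1) ^ K * sin b - sin a)
      = (e * e) * (2 * real K) + e * ((-1) ^ K * sin b - sin a)"
    by algebra
  then have "e * (2 * e * real K + (-1) ^ K * sin b - sin a) = 2 * real K + e * ((-1) ^ K * sin b - sin a)"
    using e_sq(1) by simp
  then have "e * (2 * e * real K + (-1) ^ K * sin b - sin a) > 0"
    using n assms by (simp add: abs_le_iff)
  moreover have "l + cos a + cos b > 0"
    using cos_quarter(1)[OF ab(1)] cos_quarter(1)[OF ab(2)] l by simp
  ultimately have "(e * (2 * e * real K + (-1) ^ K * sin b - sin a)) / (l + cos a + cos b) > 0"
    by (rule divide_pos_pos)
  then show ?thesis
    by (simp add: S_def slope_def)
qed

lemma S_times: "S * (l + cos a + cos b) = 2 * e * real K + (-1) ^ K * sin b - sin a"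
  using cos_quarter(1)[OF ab(1)] cos_quarter(1)[OF ab(2)] l by (simp add: S_def slope_def)

text \<open>Abscissae are compared through heights on the unfolded line, after multiplication by e S
  > 0. Within each end cap the line climbs at most 1/4, while the nearest flat side is at least 3/4
  away in height from the end of the chord.\<close>

lemma bounce_interior:
  assumes "0 < j" "j \<le> K"
  shows "0 < fst (bounce l e K a b j)" "fst (bounce l e K a b j) < l"
proof -
  define u where "u = (e * (2 * real j - 1) - sin a) / S"
  have pos: "e * S > 0"
    using slope_pos assms by simp
  then have "S \<noteq> 0"
    by auto
  then have "S * u = e * (2 * real j - 1) - sin a"
    by (simp add: u_def)
  then have "e * (S * u) = e * (e * (2 * real j - 1) - sin a)"
    by simp
  also have "\<dots> = (e * e) * (2 * real j - 1) - e * sin a"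
    by algebra
  finally have "e * (S * u) = (e * e) * (2 * real j - 1) - e * sin a" .
  then have u: "e * S * u = (2 * real j - 1) - e * sin a"
    using e_sq(1) by (simp add: algebra_simps)
  have eS: "e * S \<le> 1 / 4"
    using S_bound e by auto
  have ea: "\<bar>e * sin a\<bar> \<le> 1 / 4" "\<bar>e * ((-1) ^ K * sin b)\<bar> \<le> 1 / 4"
    using cos_quarter(2)[OF ab(1)] cos_quarter(2)[OF ab(2)] e_sq(2) by (simp_all add: abs_mult power_abs)
  have small: "e * S * c \<le> 1 / 4" if "0 \<le> c" "c \<le> 1" for c
    using mult_mono[OF eS that(2)] pos that by simp
  have "e * S * cos a \<le> 1 / 4"
    using cos_quarter(1)[OF ab(1)] by (intro small) auto
  then have "e * S * cos a < e * S * u"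
    using u ea assms by (simp add: abs_le_iff)
  then have "cos a < u"
    using pos by (simp add: mult_less_cancel_left_pos)
  then show "0 < fst (bounce l e K a b j)"
    using assms by (simp add: bounce_def u_def S_def)
  have "e * (S * (l + cos a + cos b)) = (e * e) * (2 * real K) + e * ((-1) ^ K * sin b) - e * sin a"
    unfolding S_times by (simp add: algebra_simps)
  then have "e * S * (l + cos a) + e * S * cos b = 2 * real K + e * ((-1) ^ K * sin b) - e * sin a"
    using e_sq(1) by (simp add: algebra_simps)
  moreover have "e * S * cos b \<le> 1 / 4"
    using cos_quarter(1)[OF ab(2)] by (intro small) auto
  moreover have "real j \<le> real K"
    using assms by simp
  ultimately have "e * S * u < e * S * (l + cos a)"
    using u ea by (simp add: abs_le_iff)
  then have "u < l + cos a"
    using pos by (simp add: mult_less_cancel_left_pos)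
  then show "fst (bounce l e K a b j) < l"
    using assms by (simp add: bounce_def u_def S_def)
qed

lemma bounce_step:
  assumes "j \<le> K"
  shows "\<exists>u>0. bounce l e K a b (j + 1) = ray (bounce l e K a b j) (1, (-1) ^ j * slope l e K a b) u"
proof -
  define P where "P = bounce l e K a b"
  have s2: "(-1 :: real) ^ m * (-1) ^ m = 1" for m
    by (simp flip: power_add)
  have cosp: "cos a > 0" "cos b > 0"
    using cos_quarter(1)[OF ab(1)] cos_quarter(1)[OF ab(2)] by auto
  \<comment> \<open>The direction has horizontal component 1, so the parameter \<open>u\<close> is
    the horizontal distance, and it remains to check its sign and the slope.\<close>
  have "fst (P j) < fst (P (j + 1)) \<and> snd (P (j + 1)) - snd (P j) = (-1) ^ j * S * (fst (P (j + 1)) - fst (P j))"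
  proof (cases "K = 0")
    case True
    then have "j = 0"
      using assms by simp
    then show ?thesis
      using True S_times cosp l by (simp add: P_def bounce_def algebra_simps)
  next
    case False
    then have pos: "e * S > 0"
      using slope_pos by simp
    then have S0: "S \<noteq> 0"
      by auto
    have fst_flat: "S * fst (P i) = e * (2 * real i - 1) - sin a - S * cos a" if "0 < i" "i \<le> K" for i
    proof -
      have "fst (P i) = - cos a + (e * (2 * real i - 1) - sin a) / S"
        using that by (simp add: P_def bounce_def S_def)
      then show ?thesis
        using S0 by (simp only: distrib_left) simp
    qed
    have snd_flat: "snd (P i) = - e * (-1) ^ i" if "0 < i" "i \<le> K" for i
      using that by (simp add: P_def bounce_def)
    have ends: "P 0 = (- cos a, sin a)" "P (K + 1) = (l + cos b, sin b)"
      by (simp_all add: P_def bounce_def)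
    have inner: "0 < fst (P i) \<and> fst (P i) < l" if "0 < i" "i \<le> K" for i
      using bounce_interior[OF that] by (simp add: P_def)
    consider "j = 0" | "0 < j" "j < K" | "0 < j" "j = K"
      using assms by linarith
    then show ?thesis
    proof cases
      case 1
      then show ?thesis
        using inner[of 1] fst_flat[of 1] snd_flat[of 1] False cosp by (simp add: ends algebra_simps)
    next
      case 2
      have "S * (fst (P (j + 1)) - fst (P j)) = 2 * e"
        using fst_flat[of "j + 1"] fst_flat[of j] 2 by (simp add: algebra_simps)
      then have "e * S * (fst (P (j + 1)) - fst (P j)) = e * (2 * e)"
        "(-1) ^ j * S * (fst (P (j + 1)) - fst (P j)) = (-1) ^ j * (2 * e)"
        by (simp_all only: mult.assoc)
      moreover have "e * (2 * e) = 2"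
        using e by auto
      ultimately show ?thesis
        using snd_flat[of "j + 1"] snd_flat[of j] 2 pos
          zero_less_mult_pos[of "e * S" "fst (P (j + 1)) - fst (P j)"] by simp
    next
      case 3
      have last: "P (j + 1) = (l + cos b, sin b)"
        using 3 ends by simp
      then have "S * (fst (P (j + 1)) - fst (P j)) = e + (-1) ^ K * sin b"
        using fst_flat[of j] S_times 3 by (simp add: algebra_simps)
      then have "(-1) ^ j * S * (fst (P (j + 1)) - fst (P j)) = (-1) ^ K * e + ((-1) ^ K * (-1) ^ K) * sin b"
        using 3 by (simp only: mult.assoc) (simp add: algebra_simps)
      then show ?thesis
        using inner[of j] snd_flat[of j] 3 cosp s2[of K] unfolding last by simp
    qed
  qed
  then show ?thesis
    by (intro exI[of _ "fst (P (j + 1)) - fst (P j)"]) (auto simp: P_def S_def ray_def prod_eq_iff algebra_simps)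
qed

end

section \<open>Orbits with prescribed itinerary\<close>

text \<open>All chords are computed as running from left to right; for \<open>r\<close> false the
  picture is reflected in the vertical axis of the table.\<close>

definition mirror :: "real \<Rightarrow> bool \<Rightarrow> real \<times> real \<Rightarrow> real \<times> real" where
  "mirror l r q = (if r then fst q else l - fst q, snd q)"

definition mirror_vec :: "bool \<Rightarrow> real \<times> real \<Rightarrow> real \<times> real" where
  "mirror_vec r v = (if r then fst v else - fst v, snd v)"

lemma mirror_ray: "mirror l r (ray q v t) = ray (mirror l r q) (mirror_vec r v) t"
  by (simp add: mirror_def mirror_vec_def ray_def algebra_simps)

lemma inward_normal_mirror:
  "0 < l \<Longrightarrow> inward_normal l (mirror l r q) = mirror_vec r (inward_normal l q)"
  by (auto simp: mirror_def mirror_vec_def inward_normal_def Let_def)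

lemma reflect_mirror: "reflect (mirror_vec r v) (mirror_vec r n) = mirror_vec r (reflect v n)"
  by (auto simp: mirror_vec_def reflect_def Let_def algebra_simps)

lemma norm_mirror_vec:
  "(fst (mirror_vec r v))\<^sup>2 + (snd (mirror_vec r v))\<^sup>2 = (fst v)\<^sup>2 + (snd v)\<^sup>2"
  by (simp add: mirror_vec_def)

text \<open>The angles of the reversed incoming velocity and of the outgoing velocity add up to
  twice the angle - t of the normal.\<close>

lemma reflect_circle:
  "reflect (- cos b, - sin b) (cos t, - sin t) = (cos (- 2 * t - b), sin (- 2 * t - b))"
proof -
  have "cos (- 2 * t - b) = cos (2 * t + b)" "sin (- 2 * t - b) = - sin (2 * t + b)"
    by (metis add_uminus_conv_diff cos_minus minus_add_distrib mult_minus_left)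
      (metis add_uminus_conv_diff sin_minus minus_add_distrib mult_minus_left)
  then have *: "cos (- 2 * t - b) = ((cos t)\<^sup>2 - (sin t)\<^sup>2) * cos b - 2 * sin t * cos t * sin b"
    "sin (- 2 * t - b) = - (2 * sin t * cos t * cos b + ((cos t)\<^sup>2 - (sin t)\<^sup>2) * sin b)"
    by (simp_all add: cos_add sin_add cos_double sin_double)
  have "(sin t)\<^sup>2 + (cos t)\<^sup>2 = 1"
    by simp
  then show ?thesis
    unfolding * reflect_def Let_def fst_conv snd_conv prod.inject by algebra
qed

text \<open>The predicate right tells whether the ball moves to the right after collision n.\<close>

locale coding =
  fixes w :: "int \<Rightarrow> side" and right :: "int \<Rightarrow> bool" and N :: nat and l :: real
  assumes semi: "\<And>n. forget (w n) = L \<Longrightarrow> w n = (if right n then L else R) \<and> right (n - 1) = (\<not> right n)"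
    and flat: "\<And>n. forget (w n) \<noteq> L \<Longrightarrow> right (n - 1) = right n"
    and zz: "\<And>n. forget (w n) = forget (w (n + 1)) \<Longrightarrow> forget (w n) = L"
    and ex_ahead: "\<And>n. \<exists>i\<le>N. forget (w (n + 1 + int i)) = L"
    and ex_behind: "\<And>n. \<exists>i\<le>N. forget (w (n - 1 - int i)) = L"
    and l_large: "l \<ge> 16 * (real N + 1)"
begin

section \<open>The chords of a coded trajectory\<close>

definition ahead :: "int \<Rightarrow> nat" where
  "ahead n = (LEAST i. forget (w (n + 1 + int i)) = L)"

definition behind :: "int \<Rightarrow> nat" where
  "behind n = (LEAST i. forget (w (n - 1 - int i)) = L)"

definition sg :: "int \<Rightarrow> real" where
  "sg n = (if w n = T then 1 else -1)"

text \<open>The angle of the collision point on a semicircle; the values at flat collisions are never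
  used.\<close>

definition good_angles :: "(int \<Rightarrow> real) \<Rightarrow> bool" where
  "good_angles \<theta> \<longleftrightarrow> (\<forall>n. \<bar>\<theta> n\<bar> \<le> 1 / 4) \<and> (\<forall>n.
     - (arctan (slope l (sg (n + 1)) (ahead n) (\<theta> n) (\<theta> (n + 1 + int (ahead n))))
      + arctan (slope l (sg (n - 1)) (behind n) (\<theta> n) (\<theta> (n - 1 - int (behind n))))) / 2 = \<theta> n)"

definition \<theta> :: "int \<Rightarrow> real" where
  "\<theta> = (SOME \<theta>. good_angles \<theta>)"

text \<open>The semicircle collision from which the chord leaving collision \<open>n\<close>
  originates. On a semicircle this is \<open>n\<close> itself, so \<open>vel\<close> is the velocity
  just after the collision.\<close>

definition start :: "int \<Rightarrow> int" where
  "start n = (if forget (w n) = L then n else n - 1 - int (behind n))"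

definition S :: "int \<Rightarrow> real" where
  "S p = slope l (sg (p + 1)) (ahead p) (\<theta> p) (\<theta> (p + 1 + int (ahead p)))"

definition run :: "int \<Rightarrow> nat \<Rightarrow> real \<times> real" where
  "run p j = bounce l (sg (p + 1)) (ahead p) (\<theta> p) (\<theta> (p + 1 + int (ahead p))) j"

definition heading :: "int \<Rightarrow> nat \<Rightarrow> real \<times> real" where
  "heading p j = (cos (arctan ((-1) ^ j * S p)), sin (arctan ((-1) ^ j * S p)))"

definition pos :: "int \<Rightarrow> real \<times> real" where
  "pos n = mirror l (right n) (run (start n) (nat (n - start n)))"

definition vel :: "int \<Rightarrow> real \<times> real" where
  "vel n = mirror_vec (right n) (heading (start n) (nat (n - start n)))"

lemma l_pos: "0 < l"
  by (rule less_le_trans[OF _ l_large]) simp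

lemma ahead: "forget (w (n + 1 + int (ahead n))) = L" "ahead n \<le> N"
  "i < ahead n \<Longrightarrow> forget (w (n + 1 + int i)) \<noteq> L"
proof -
  obtain i where i: "i \<le> N" "forget (w (n + 1 + int i)) = L"
    using ex_ahead by blast
  show "forget (w (n + 1 + int (ahead n))) = L"
    unfolding ahead_def by (rule LeastI[of _ i]) (rule i)
  show "ahead n \<le> N"
    using Least_le[of "\<lambda>i. forget (w (n + 1 + int i)) = L", OF i(2)] i(1) by (simp add: ahead_def)
  show "i < ahead n \<Longrightarrow> forget (w (n + 1 + int i)) \<noteq> L" for i
    unfolding ahead_def by (rule not_less_Least)
qed

lemma behind: "forget (w (n - 1 - int (behind n))) = L" "behind n \<le> N"
  "i < behind n \<Longrightarrow> forget (w (n - 1 - int i)) \<noteq> L"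
proof -
  obtain i where i: "i \<le> N" "forget (w (n - 1 - int i)) = L"
    using ex_behind by blast
  show "forget (w (n - 1 - int (behind n))) = L"
    unfolding behind_def by (rule LeastI[of _ i]) (rule i)
  show "behind n \<le> N"
    using Least_le[of "\<lambda>i. forget (w (n - 1 - int i)) = L", OF i(2)] i(1) by (simp add: behind_def)
  show "i < behind n \<Longrightarrow> forget (w (n - 1 - int i)) \<noteq> L" for i
    unfolding behind_def by (rule not_less_Least)
qed

lemma behind_eq:
  assumes "forget (w p) = L" "p < n" "\<And>i. p < i \<Longrightarrow> i < n \<Longrightarrow> forget (w i) \<noteq> L"
  shows "n - 1 - int (behind n) = p"
proof (rule ccontr)
  assume ne: "n - 1 - int (behind n) \<noteq> p"
  show False
  proof (cases "n - 1 - int (behind n) < p")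
    case True
    then have "nat (n - 1 - p) < behind n"
      using assms(2) by auto
    then show False
      using behind(3)[of "nat (n - 1 - p)" n] assms(1,2) by simp
  next
    case False
    then show False
      using assms(3)[of "n - 1 - int (behind n)"] behind(1)[of n] ne by simp
  qed
qed

lemma no_semi_in_run:
  assumes "p < i" "i < p + 1 + int (ahead p)"
  shows "forget (w i) \<noteq> L"
proof -
  have "i = p + 1 + int (nat (i - p - 1))" "nat (i - p - 1) < ahead p"
    using assms by auto
  then show ?thesis
    using ahead(3)[of "nat (i - p - 1)" p] by metis
qed

lemma start_run:
  assumes "forget (w p) = L" "j \<le> ahead p"
  shows "start (p + int j) = p"
proof (cases "j = 0")
  case True
  then show ?thesis
    using assms by (simp add: start_def)
next
  case False
  then have "forget (w (p + int j)) \<noteq> L"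
    using assms by (intro no_semi_in_run[of p]) auto
  then show ?thesis
    using behind_eq[OF assms(1), of "p + int j"] False assms(2) no_semi_in_run[of p]
    by (simp add: start_def)
qed

text \<open>Cutting the trajectory at the semicircles reduces every statement about collision
  \<open>n\<close> to one chord, on which the formulas for \<open>bounce\<close> apply.\<close>

lemma run_cases:
  obtains p j where "forget (w p) = L" "j \<le> ahead p" "n = p + int j"
proof (cases "forget (w n) = L")
  case True
  then show ?thesis
    using that[of n 0] by simp
next
  case False
  define p where "p = n - 1 - int (behind n)"
  have "forget (w p) = L"
    using behind(1) by (simp add: p_def)
  moreover have "behind n + 1 \<le> ahead p"
  proof (rule ccontr)
    assume "\<not> behind n + 1 \<le> ahead p"
    then have "ahead p \<le> behind n"
      by simp
    have q: "forget (w (p + 1 + int (ahead p))) = L"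
      using ahead(1) .
    show False
    proof (cases "ahead p = behind n")
      case True
      then show ?thesis
        using q False by (simp add: p_def)
    next
      case neq: False
      then have "forget (w (n - 1 - int (behind n - 1 - ahead p))) \<noteq> L"
        using \<open>ahead p \<le> behind n\<close> by (intro behind(3)) simp
      moreover have "n - 1 - int (behind n - 1 - ahead p) = p + 1 + int (ahead p)"
        using neq \<open>ahead p \<le> behind n\<close> by (simp add: p_def of_nat_diff)
      ultimately show ?thesis
        using q by (simp only: simp_thms)
    qed
  qed
  ultimately show ?thesis
    using that[of p "behind n + 1"] by (simp add: p_def)
qed

lemma right_run:
  assumes "j \<le> ahead p"
  shows "right (p + int j) = right p"
  using assms
proof (induction j)
  case (Suc j)
  have "forget (w (p + int (Suc j))) \<noteq> L"
    using Suc.prems by (intro no_semi_in_run[of p]) auto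
  then have "right (p + int (Suc j) - 1) = right (p + int (Suc j))"
    by (rule flat)
  then show ?case
    using Suc by simp
qed simp

lemma sg_abs [simp]: "\<bar>sg n\<bar> = 1"
  by (simp add: sg_def)

lemma sg_cases: "sg n = 1 \<or> sg n = -1"
  by (simp add: sg_def)

text \<open>Without semicircles in between, \<open>zz\<close> forces top and bottom to alternate,
  which matches the sign produced by folding in \<open>bounce\<close>.\<close>

lemma sg_run:
  assumes "j < ahead p"
  shows "sg (p + 1 + int j) = sg (p + 1) * (-1) ^ j"
  using assms
proof (induction j)
  case (Suc j)
  define n where "n = p + 1 + int j"
  have "forget (w n) \<noteq> L" "forget (w (n + 1)) \<noteq> L"
    using ahead(3)[of j p] ahead(3)[of "Suc j" p] Suc.prems by (simp_all add: n_def algebra_simps)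
  moreover have "forget (w n) \<noteq> forget (w (n + 1))"
    using zz[of n] calculation by blast
  ultimately have "sg (n + 1) = - sg n"
    by (cases "w n"; cases "w (n + 1)") (auto simp: sg_def)
  then show ?case
    using Suc by (simp add: n_def algebra_simps)
qed simp

lemma good_angles_theta: "good_angles \<theta>"
proof -
  \<comment> \<open>The equations are solved at every integer, flat collisions included, so that the
    index type is simply \<open>int\<close>.\<close>
  have "\<exists>\<theta>. good_angles \<theta>"
    unfolding good_angles_def
    using angles_exist[of "\<lambda>n. sg (n + 1)" "\<lambda>n. sg (n - 1)" ahead N behind l
        "\<lambda>n. n + 1 + int (ahead n)" "\<lambda>n. n - 1 - int (behind n)"] ahead(2) behind(2) l_large
    by simp
  then show ?thesis
    unfolding \<theta>_def by (rule someI_ex)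
qed

lemma theta_le: "\<bar>\<theta> n\<bar> \<le> 1 / 4"
  using good_angles_theta by (simp add: good_angles_def)

lemma behind_ahead:
  assumes "forget (w p) = L"
  shows "behind (p + 1 + int (ahead p)) = ahead p"
  using behind_eq[OF assms, of "p + 1 + int (ahead p)"] no_semi_in_run[of p] by simp

text \<open>The slope of a chord seen from its far end; the fixed point equation then becomes the
  law of reflection.\<close>

lemma theta_reflection:
  assumes "forget (w p) = L"
  defines "q \<equiv> p + 1 + int (ahead p)"
  shows "arctan (S q) = - 2 * \<theta> q - (- arctan ((-1) ^ ahead p * S p))"
proof -
  have "\<theta> q = - (arctan (S q)
      + arctan (slope l (sg (q - 1)) (behind q) (\<theta> q) (\<theta> (q - 1 - int (behind q))))) / 2"
    using good_angles_theta by (simp add: good_angles_def S_def)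
  moreover have "slope l (sg (q - 1)) (behind q) (\<theta> q) (\<theta> (q - 1 - int (behind q)))
      = - ((-1) ^ ahead p * S p)"
  proof -
    \<comment> \<open>The last flat collision has offset \<open>ahead p - 1\<close>; this shift by
      one produces the minus sign required by \<open>slope_reverse\<close>.\<close>
    have "sg (q - 1) = - sg (p + 1) * (-1) ^ ahead p" if "ahead p > 0"
    proof -
      have "q - 1 = p + 1 + int (ahead p - 1)"
        using that by (simp add: q_def)
      then have "sg (q - 1) = sg (p + 1) * (-1) ^ (ahead p - 1)"
        using sg_run[of "ahead p - 1" p] that by simp
      moreover have "(-1 :: real) ^ ahead p = - ((-1) ^ (ahead p - 1))"
        using that by (cases "ahead p") auto
      ultimately show ?thesis
        by simp
    qed
    moreover have "behind q = ahead p" "q - 1 - int (behind q) = p"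
      using behind_ahead[OF assms(1)] by (simp_all add: q_def)
    ultimately show ?thesis
      using slope_reverse[of "ahead p" "sg (q - 1)" "sg (p + 1)" l "\<theta> q" "\<theta> p"]
      by (simp add: S_def q_def)
  qed
  ultimately show ?thesis
    by (simp add: arctan_minus)
qed

lemma pos_run:
  assumes "forget (w p) = L" "j \<le> ahead p"
  shows "pos (p + int j) = mirror l (right p) (run p j)"
    "vel (p + int j) = mirror_vec (right p) (heading p j)"
  using start_run[OF assms] right_run[OF assms(2)] by (simp_all add: pos_def vel_def)

lemma run_0: "run p 0 = (- cos (\<theta> p), sin (\<theta> p))"
  by (simp add: run_def bounce_def)

text \<open>Collision \<open>q\<close> ends one chord and starts the next. Both descriptions agree
  because the frame is mirrored there, which exchanges l + cos and - cos.\<close>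

lemma run_end:
  assumes "forget (w p) = L"
  defines "q \<equiv> p + 1 + int (ahead p)"
  shows "right q = (\<not> right p)" "pos q = mirror l (right p) (run p (ahead p + 1))"
    "pos q = mirror l (right q) (- cos (\<theta> q), sin (\<theta> q))"
proof -
  have q: "forget (w q) = L"
    using ahead(1) by (simp add: q_def)
  then show r: "right q = (\<not> right p)"
    using semi[of q] right_run[of "ahead p" p] by (simp add: q_def)
  show p: "pos q = mirror l (right q) (- cos (\<theta> q), sin (\<theta> q))"
    using pos_run(1)[OF q, of 0] by (simp add: run_0)
  then show "pos q = mirror l (right p) (run p (ahead p + 1))"
    using r by (simp add: run_def bounce_def mirror_def q_def)
qed

lemma run_flat:
  assumes "0 < j" "j \<le> ahead p"
  shows "0 < fst (run p j)" "fst (run p j) < l" "snd (run p j) = sg (p + int j)"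
proof -
  show "0 < fst (run p j)" "fst (run p j) < l"
    using bounce_interior[OF theta_le[of p] theta_le[of "p + 1 + int (ahead p)"] sg_cases[of "p + 1"]
      ahead(2)[of p] l_large refl assms] by (simp_all add: run_def)
  have "p + int j = p + 1 + int (j - 1)" "(-1 :: real) ^ j = - ((-1) ^ (j - 1))"
    using assms by (auto simp: of_nat_diff power_eq_if)
  then show "snd (run p j) = sg (p + int j)"
    using sg_run[of "j - 1" p] assms by (simp add: run_def bounce_def)
qed

lemma label_flat:
  assumes "0 < j" "j \<le> ahead p"
  shows "w (p + int j) = T \<and> sg (p + int j) = 1 \<or> w (p + int j) = B \<and> sg (p + int j) = -1"
  using no_semi_in_run[of p "p + int j"] assms by (cases "w (p + int j)") (auto simp: sg_def)

section \<open>The coded trajectory is a billiard orbit\<close>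

lemma pos_mem_piece: "pos n \<in> piece l (w n)"
proof -
  obtain p j where pj: "forget (w p) = L" "j \<le> ahead p" "n = p + int j"
    by (rule run_cases)
  show ?thesis
  proof (cases "j = 0")
    case True
    have "cos (\<theta> p) > 0"
      using cos_quarter(1)[OF theta_le] .
    then show ?thesis
      using pj pos_run(1)[OF pj(1,2)] True semi[OF pj(1)]
      by (auto simp: run_0 piece_def mirror_def)
  next
    case False
    then show ?thesis
      using pj pos_run(1)[OF pj(1,2)] run_flat[of j p] label_flat[of j p]
      by (auto simp: piece_def mirror_def)
  qed
qed

text \<open>Junctions belong to two pieces, and \<open>K_set\<close> speaks of pieces rather than
  letters, so a converse to \<open>pos_mem_piece\<close> is needed. It holds because flat collisions
  lie strictly between the junctions.\<close>

lemma pos_semicircle: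
  shows "pos n \<in> piece l L \<Longrightarrow> w n = L" and "pos n \<in> piece l R \<Longrightarrow> w n = R"
proof -
  obtain p j where pj: "forget (w p) = L" "j \<le> ahead p" "n = p + int j"
    by (rule run_cases)
  have "(pos n \<in> piece l L \<longrightarrow> w n = L) \<and> (pos n \<in> piece l R \<longrightarrow> w n = R)"
  proof (cases "j = 0")
    case True
    have "cos (\<theta> p) > 0"
      using cos_quarter(1)[OF theta_le] .
    then show ?thesis
      using pj pos_run(1)[OF pj(1,2)] True semi[OF pj(1)] l_pos
      by (auto simp: run_0 piece_def mirror_def split: if_splits)
  next
    case False
    then show ?thesis
      using pj pos_run(1)[OF pj(1,2)] run_flat[of j p]
      by (auto simp: piece_def mirror_def)
  qed
  then show "pos n \<in> piece l L \<Longrightarrow> w n = L" and "pos n \<in> piece l R \<Longrightarrow> w n = R"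
    by auto
qed

lemma no_semicircle_twice: "w n = L \<Longrightarrow> w (n + 1) \<noteq> L" "w n = R \<Longrightarrow> w (n + 1) \<noteq> R"
  using semi[of n] semi[of "n + 1"] by auto

lemma pos_step: "\<exists>t>0. pos (n + 1) = ray (pos n) (vel n) t"
proof -
  obtain p j where pj: "forget (w p) = L" "j \<le> ahead p" "n = p + int j"
    by (rule run_cases)
  have "pos (n + 1) = mirror l (right p) (run p (j + 1))"
  proof (cases "j = ahead p")
    case True
    then show ?thesis
      using run_end(2)[OF pj(1)] pj by (simp add: algebra_simps)
  next
    case False
    then show ?thesis
      using pos_run(1)[OF pj(1), of "j + 1"] pj by (simp add: algebra_simps)
  qed
  moreover obtain u where "u > 0" and
    u: "run p (j + 1) = ray (run p j) (1, (-1) ^ j * S p) u"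
    using bounce_step[OF theta_le[of p] theta_le[of "p + 1 + int (ahead p)"] sg_cases[of "p + 1"]
      ahead(2)[of p] l_large refl pj(2)] unfolding run_def S_def by blast
  \<comment> \<open>Scaling by the cosine turns the direction (1, slope) into the unit vector
    \<open>heading\<close>, and the time \<open>u\<close> into \<open>u / c\<close>.\<close>
  moreover define c where "c = cos (arctan ((-1) ^ j * S p))"
  have "c > 0"
    by (simp add: c_def cos_arctan add_pos_nonneg)
  have "heading p j = (c, c * ((-1) ^ j * S p))"
    by (simp add: heading_def c_def cos_arctan sin_arctan)
  then have "ray (run p j) (1, (-1) ^ j * S p) u = ray (run p j) (heading p j) (u / c)"
    using \<open>c > 0\<close> by (simp add: ray_def)
  ultimately show ?thesis
    using pos_run[OF pj(1,2)] pj(3) \<open>c > 0\<close>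
    by (intro exI[of _ "u / c"]) (simp add: mirror_ray)
qed

text \<open>At a flat side the normal is vertical and the slope changes sign. At a semicircle,
  \<open>theta_reflection\<close> is the angle relation of \<open>reflect_circle\<close>.\<close>

lemma vel_step: "reflect (vel n) (inward_normal l (pos (n + 1))) = vel (n + 1)"
proof -
  obtain p j where pj: "forget (w p) = L" "j \<le> ahead p" "n = p + int j"
    by (rule run_cases)
  show ?thesis
  proof (cases "j = ahead p")
    case False
    then have j: "0 < j + 1" "j + 1 \<le> ahead p"
      using pj by simp_all
    have n1: "n + 1 = p + int (j + 1)"
      using pj(3) by simp
    have "inward_normal l (run p (j + 1)) = (0, - snd (run p (j + 1)))"
      using run_flat(1,2)[OF j] by (simp add: inward_normal_def Let_def)
    moreover have "snd (run p (j + 1)) * snd (run p (j + 1)) = 1"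
      using run_flat(3)[OF j] sg_cases[of "p + int (j + 1)"] by auto
    ultimately have "reflect (heading p j) (inward_normal l (run p (j + 1)))
        = (fst (heading p j), - snd (heading p j))"
      by (simp add: reflect_def Let_def)
    also have "\<dots> = heading p (j + 1)"
      by (simp add: heading_def arctan_minus)
    finally show ?thesis
      unfolding n1 pos_run[OF pj(1) j(2)] unfolding pj(3) pos_run(2)[OF pj(1,2)]
      by (simp only: inward_normal_mirror[OF l_pos] reflect_mirror)
  next
    case True
    define q where "q = p + 1 + int (ahead p)"
    \<comment> \<open>The angle of the reversed incoming velocity in the frame of the chord leaving
      \<open>q\<close>.\<close>
    define \<beta> where "\<beta> = - arctan ((-1) ^ ahead p * S p)"
    have q: "forget (w q) = L" "n + 1 = q"
      using ahead(1) pj True by (simp_all add: q_def)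
    have "vel n = mirror_vec (right q) (- cos \<beta>, - sin \<beta>)"
      using pos_run(2)[OF pj(1,2)] pj(3) True run_end(1)[OF pj(1)]
      by (simp add: heading_def \<beta>_def mirror_vec_def q_def)
    moreover have "inward_normal l (pos (n + 1)) = mirror_vec (right q) (cos (\<theta> q), - sin (\<theta> q))"
      using run_end(3)[OF pj(1)] q l_pos cos_quarter(1)[OF theta_le[of q]]
      by (simp add: inward_normal_mirror q_def[symmetric]) (simp add: inward_normal_def)
    moreover have "vel (n + 1) = mirror_vec (right q) (cos (arctan (S q)), sin (arctan (S q)))"
      using pos_run(2)[OF q(1), of 0] q(2) by (simp add: heading_def)
    moreover have "arctan (S q) = - 2 * \<theta> q - \<beta>"
      using theta_reflection[OF pj(1)] by (simp add: q_def \<beta>_def)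
    ultimately show ?thesis
      by (simp only: reflect_mirror reflect_circle)
  qed
qed

text \<open>Semicircle collisions have height at most 1/4 in absolute value, so height 1 or -1
  determines the letter and \<open>zz\<close> excludes a repetition.\<close>

lemma not_same_flat: "\<not> (snd (pos n) = snd (pos (n + 1)) \<and> \<bar>snd (pos n)\<bar> = 1)"
proof -
  have label: "w m = (if snd (pos m) = 1 then T else B)" if h: "\<bar>snd (pos m)\<bar> = 1" for m
  proof -
    obtain p j where pj: "forget (w p) = L" "j \<le> ahead p" "m = p + int j"
      by (rule run_cases)
    show ?thesis
    proof (cases "j = 0")
      case True
      then show ?thesis
        using h pj pos_run(1)[OF pj(1,2)] cos_quarter(2)[OF theta_le[of p]]
        by (simp add: run_0 mirror_def)
    next
      case False
      then show ?thesis
        using pj pos_run(1)[OF pj(1,2)] run_flat(3)[of j p] label_flat[of j p]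
        by (auto simp: mirror_def)
    qed
  qed
  show ?thesis
  proof
    assume "snd (pos n) = snd (pos (n + 1)) \<and> \<bar>snd (pos n)\<bar> = 1"
    then show False
      using label[of n] label[of "n + 1"] zz[of n] by (cases "snd (pos (n + 1)) = 1") auto
  qed
qed

lemma norm_vel: "(fst (vel n))\<^sup>2 + (snd (vel n))\<^sup>2 = 1"
  unfolding vel_def norm_mirror_vec heading_def by simp

lemma coded_orbit: "full_orbit l (phase_point l (pos 0) (vel 0)) (\<lambda>n. phase_point l (pos n) (vel n))"
  unfolding full_orbit_def
proof (intro conjI allI)
  fix n
  obtain t where t: "t > 0" "pos (n + 1) = ray (pos n) (vel n) t"
    using pos_step by blast
  have "pos m \<in> stadium_boundary l" for m
    using pos_mem_piece piece_subset_boundary by blast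
  then show "billiard_map l (phase_point l (pos n) (vel n)) = Some (phase_point l (pos (n + 1)) (vel (n + 1)))"
    using billiard_map_phase_point[OF l_pos t(1), of "pos n" "vel n"] norm_vel not_same_flat[of n] vel_step[of n]
    unfolding t(2)[symmetric] by metis
qed simp

lemma coded_point: "\<exists>x\<in>K_set l. itinerary l x w"
proof (intro bexI)
  let ?x = "phase_point l (pos 0) (vel 0)" and ?xs = "\<lambda>n. phase_point l (pos n) (vel n)"
  have fst: "fst (phase_point l q v) = q" for q v
    by (simp add: phase_point_def)
  show "itinerary l ?x w"
    unfolding itinerary_def by (rule exI[of _ ?xs]) (simp add: coded_orbit pos_mem_piece fst)
  show "?x \<in> K_set l"
    unfolding K_set_def mem_Collect_eq fst
  proof (intro exI[of _ ?xs] conjI allI coded_orbit)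
    show "\<not> (fst (?xs n) \<in> piece l L \<and> fst (?xs (n + 1)) \<in> piece l L)"
      "\<not> (fst (?xs n) \<in> piece l R \<and> fst (?xs (n + 1)) \<in> piece l R)" for n
      unfolding fst using pos_semicircle no_semicircle_twice by blast+
  qed
qed

end

section \<open>Counting words\<close>

definition words :: "real \<Rightarrow> nat \<Rightarrow> side list set" where
  "words l n = {u. length u = n \<and>
      (\<exists>x \<in> K_set l. \<exists>w. itinerary l x w \<and> (\<exists>k::int. u = map (\<lambda>i. w (k + int i)) [0..<n]))}"

lemma W_count_eq: "W_count l n = card (words l n)"
  by (simp add: W_count_def words_def)

text \<open>A point whose orbit meets a junction may have several itineraries; the properties of
  \<open>w\<close> are therefore derived from membership in pieces alone.\<close>

lemma words_subset:
  assumes "0 < l"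
  shows "words l n \<subseteq> alternate L ` zigzags L n \<union> alternate R ` zigzags L n"
proof
  fix u assume "u \<in> words l n"
  then obtain x w k where x: "x \<in> K_set l" "itinerary l x w" and u: "u = map (\<lambda>i. w (k + int i)) [0..<n]"
    by (auto simp: words_def)
  obtain xs where xs: "full_orbit l x xs"
    and K: "\<And>n. \<not> (fst (xs n) \<in> piece l L \<and> fst (xs (n + 1)) \<in> piece l L)"
      "\<And>n. \<not> (fst (xs n) \<in> piece l R \<and> fst (xs (n + 1)) \<in> piece l R)"
    using x(1) by (auto simp: K_set_def)
  have w: "fst (xs n) \<in> piece l (w n)" for n
    using x(2) full_orbit_unique[OF xs _ assms] by (auto simp: itinerary_def)
  have step: "billiard_map l (xs n) = Some (xs (n + 1))" for n
    using xs by (simp add: full_orbit_def)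
  have flat: "w n = T \<or> w n = B" if "forget (w n) \<noteq> L" for n
    using that by (cases "w n") auto
  have "forget (w n) = L" if "forget (w n) = forget (w (n + 1))" for n
  proof (rule ccontr)
    assume "forget (w n) \<noteq> L"
    then have "w n = T \<or> w n = B" "w (n + 1) = w n"
      using flat[of n] flat[of "n + 1"] that by auto
    then show False
      using no_repeated_flat_side[OF step assms, of "w n" n] w[of n] w[of "n + 1"] by metis
  qed
  moreover have "w b = flip (w a)"
    if ab: "a < b" "forget (w a) = L" "forget (w b) = L" "\<And>i. a < i \<Longrightarrow> i < b \<Longrightarrow> forget (w i) \<noteq> L" for a b
  proof -
    have "fst (xs i) \<in> piece l T \<or> fst (xs i) \<in> piece l B" if "a < i" "i < b" for i
      using flat[OF ab(4)[OF that]] w[of i] by metis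
    note alt = semicircles_alternate[where xs = xs, OF assms step K ab(1) this]
    have "w b \<noteq> w a"
    proof
      assume "w b = w a"
      moreover have "w a = L \<or> w a = R"
        using ab(2) by (simp add: forget_eq_L_iff)
      ultimately show False
        using alt w[of a] w[of b] by auto
    qed
    then show ?thesis
      using ab(2,3) by (auto simp: forget_eq_L_iff)
  qed
  ultimately show "u \<in> alternate L ` zigzags L n \<union> alternate R ` zigzags L n"
    unfolding u by (rule map_in_alternate_zigzags)
qed

lemma W_count_le:
  assumes "0 < l"
  shows "real (W_count l n) \<le> 2 * sqrt 2 * (1 + sqrt 2) ^ n"
proof -
  have "card (words l n) \<le> card (alternate L ` zigzags L n \<union> alternate R ` zigzags L n)"
    by (intro card_mono words_subset assms) auto
  also have "\<dots> \<le> card (alternate L ` zigzags L n) + card (alternate R ` zigzags L n)"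
    by (rule card_Un_le)
  also have "\<dots> \<le> card (zigzags L n) + card (zigzags L n)"
    by (intro add_mono card_image_le) auto
  finally have "real (card (words l n)) \<le> 2 * real (card (zigzags L n))"
    by simp
  also have "\<dots> \<le> 2 * (sqrt 2 * (1 + sqrt 2) ^ n)"
    using card_zigzags_le[of n] by (intro mult_left_mono) auto
  finally show ?thesis
    by (simp add: W_count_eq)
qed

text \<open>Recursion from 0 in both directions. It supplies the direction of motion, which has to
  switch exactly at the semicircles.\<close>

lemma parity_exists:
  fixes f :: "int \<Rightarrow> bool"
  shows "\<exists>r. \<forall>n. r (n - 1) = (r n \<noteq> f n)"
proof -
  define p where "p = rec_nat True (\<lambda>k b. b \<noteq> f (int k + 1))"
  define q where "q = rec_nat True (\<lambda>k b. b \<noteq> f (- int k))"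
  define r where "r n = (if n \<ge> 0 then p (nat n) else q (nat (- n)))" for n
  have p: "p (Suc k) = (p k \<noteq> f (int k + 1))" "p 0" for k
    by (simp_all add: p_def)
  have q: "q (Suc k) = (q k \<noteq> f (- int k))" "q 0" for k
    by (simp_all add: q_def)
  have "r (n - 1) = (r n \<noteq> f n)" for n
  proof (cases "n > 0")
    case True
    define k where "k = nat (n - 1)"
    then have "n = int k + 1"
      using True by simp
    then show ?thesis
      using p(1)[of k] by (auto simp: r_def nat_add_distrib)
  next
    case False
    define k where "k = nat (- n)"
    then have n: "n = - int k"
      using False by simp
    have "nat (1 + int k) = Suc k"
      by simp
    then have "r (n - 1) = q (Suc k)" "r n = q k"
      using p(2) q(2) by (auto simp: r_def n)
    then show ?thesis
      using q(1)[of k] n by simp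
  qed
  then show ?thesis by blast
qed

section \<open>Free concatenation of zigzag blocks\<close>

lemma zigzag_nth:
  assumes "zigzag p u" "Suc i < length u" "u ! i = u ! Suc i"
  shows "u ! i = L"
  using assms
proof (induction u arbitrary: p i)
  case (Cons s u)
  then show ?case
    by (cases i; cases u) auto
qed simp

lemma zigzag_nth_neq_R: "zigzag p u \<Longrightarrow> i < length u \<Longrightarrow> u ! i \<noteq> R"
  by (induction u arbitrary: p i) (auto simp: nth_Cons split: nat.split)

text \<open>Blocks consisting of an L followed by a zigzag word can be concatenated freely.\<close>

definition code_word :: "nat \<Rightarrow> side list list \<Rightarrow> int \<Rightarrow> side" where
  "code_word N bs n = (let i = n div int (N + 1) in
     (L # (if 0 \<le> i \<and> i < int (length bs) then bs ! nat i else replicate N L)) ! nat (n mod int (N + 1)))"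

lemma zigzag_replicate_L: "zigzag L (replicate n L)"
  by (induction n) auto

text \<open>The padding by \<open>L\<close> is itself a zigzag word, so later arguments treat all
  blocks alike, inside and outside the range of \<open>bs\<close>.\<close>

lemma code_word_block:
  assumes "set bs \<subseteq> zigzags L N"
  obtains b where "b \<in> zigzags L N"
    "\<And>m. m div int (N + 1) = n div int (N + 1) \<Longrightarrow> code_word N bs m = (L # b) ! nat (m mod int (N + 1))"
proof
  let ?i = "n div int (N + 1)"
  let ?b = "if 0 \<le> ?i \<and> ?i < int (length bs) then bs ! nat ?i else replicate N L"
  show "?b \<in> zigzags L N"
  proof (cases "0 \<le> ?i \<and> ?i < int (length bs)")
    case True
    then have "nat ?i < length bs"
      by linarith
    then have "bs ! nat ?i \<in> zigzags L N"
      using assms nth_mem by blast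
    then show ?thesis
      using True by simp
  next
    case False
    then have "?b = replicate N L"
      by auto
    then show ?thesis
      by (simp only:) (simp add: zigzags_def zigzag_replicate_L)
  qed
  show "code_word N bs m = (L # ?b) ! nat (m mod int (N + 1))" if "m div int (N + 1) = n div int (N + 1)" for m
    by (simp only: code_word_def Let_def that)
qed

lemma code_word_L: "n mod int (N + 1) = 0 \<Longrightarrow> code_word N bs n = L"
  by (simp add: code_word_def)

lemma code_word_neq_R:
  assumes "set bs \<subseteq> zigzags L N"
  shows "code_word N bs n \<noteq> R"
proof -
  obtain b where b: "b \<in> zigzags L N" "code_word N bs n = (L # b) ! nat (n mod int (N + 1))"
    using code_word_block[OF assms, of n] by metis
  have "nat (n mod int (N + 1)) < length (L # b)"
    using b(1) pos_mod_bound[of "int (N + 1)" n] by (simp add: zigzags_def nat_less_iff)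
  moreover have "zigzag L (L # b)"
    using b(1) by (simp add: zigzags_def)
  ultimately show ?thesis
    unfolding b(2) by (intro zigzag_nth_neq_R)
qed

text \<open>Inside a block this is the zigzag condition; across a block boundary the second letter
  is the leading \<open>L\<close>.\<close>

lemma code_word_step:
  assumes "set bs \<subseteq> zigzags L N" "code_word N bs n = code_word N bs (n + 1)"
  shows "code_word N bs n = L"
proof (cases "(n + 1) mod int (N + 1) = 0")
  case True
  then show ?thesis
    using assms(2) code_word_L by simp
next
  case False
  define m where "m = n mod int (N + 1)"
  obtain b where b: "b \<in> zigzags L N"
    "\<And>m. m div int (N + 1) = n div int (N + 1) \<Longrightarrow> code_word N bs m = (L # b) ! nat (m mod int (N + 1))"
    using code_word_block[OF assms(1), of n] by metis
  have m: "0 \<le> m" "m < int (N + 1)"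
    by (simp_all add: m_def)
  have "m + 1 \<noteq> int (N + 1)"
    using False by (metis m_def mod_add_left_eq mod_self)
  then have m1: "m + 1 < int (N + 1)"
    using m by simp
  have n: "n + 1 = int (N + 1) * (n div int (N + 1)) + (m + 1)"
    by (simp add: m_def)
  have "(n + 1) div int (N + 1) = n div int (N + 1)" "(n + 1) mod int (N + 1) = m + 1"
    by (rule int_div_pos_eq[OF n] int_mod_pos_eq[OF n]; use m m1 in simp)+
  then have "code_word N bs n = (L # b) ! nat m" "code_word N bs (n + 1) = (L # b) ! Suc (nat m)"
    using b(2)[of n] b(2)[of "n + 1"] m by (simp_all add: m_def nat_add_distrib)
  moreover have "Suc (nat m) < length (L # b)" "zigzag L (L # b)"
    using b(1) m m1 by (auto simp: zigzags_def)
  ultimately show ?thesis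
    using zigzag_nth[of L "L # b" "nat m"] assms(2) by metis
qed

lemma code_word_realised:
  assumes "set bs \<subseteq> zigzags L N" "l \<ge> 16 * (real N + 1)"
  shows "\<exists>x\<in>K_set l. \<exists>w. itinerary l x w \<and> (\<forall>n. forget (w n) = code_word N bs n)"
proof -
  obtain r where r: "\<And>n. r (n - 1) = (r n \<noteq> (code_word N bs n = L))"
    using parity_exists[of "\<lambda>n. code_word N bs n = L"] by blast
  define w where "w n = (if code_word N bs n = L then (if r n then L else R) else code_word N bs n)" for n
  have fw: "forget (w n) = code_word N bs n" for n
    using code_word_neq_R[OF assms(1), of n] by (cases "code_word N bs n") (auto simp: w_def)
  interpret coding w r N l
  proof
    show "w n = (if r n then L else R) \<and> r (n - 1) = (\<not> r n)" if "forget (w n) = L" for n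
      using that r[of n] unfolding fw by (simp add: w_def)
    show "r (n - 1) = r n" if "forget (w n) \<noteq> L" for n
      using that r[of n] unfolding fw by simp
    show "forget (w n) = L" if "forget (w n) = forget (w (n + 1))" for n
      using code_word_step[OF assms(1)] that unfolding fw by blast
    show "\<exists>i\<le>N. forget (w (n + 1 + int i)) = L" for n
    proof (intro exI conjI)
      \<comment> \<open>The distance from \<open>n + 1\<close> up to the next multiple of
        \<open>N + 1\<close>, where a block starts with \<open>L\<close>.\<close>
      let ?i = "nat ((- (n + 1)) mod int (N + 1))"
      have i: "int ?i = (- (n + 1)) mod int (N + 1)"
        by simp
      have "(- (n + 1)) mod int (N + 1) < int (N + 1)"
        by (rule pos_mod_bound) simp
      then show "?i \<le> N"
        by linarith
      show "forget (w (n + 1 + int ?i)) = L"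
        unfolding fw i by (rule code_word_L) (simp add: mod_add_right_eq)
    qed
    show "\<exists>i\<le>N. forget (w (n - 1 - int i)) = L" for n
    proof (intro exI conjI)
      \<comment> \<open>The distance from \<open>n - 1\<close> down to the last multiple of
        \<open>N + 1\<close>.\<close>
      let ?i = "nat ((n - 1) mod int (N + 1))"
      have i: "int ?i = (n - 1) mod int (N + 1)"
        by simp
      have "(n - 1) mod int (N + 1) < int (N + 1)"
        by (rule pos_mod_bound) simp
      then show "?i \<le> N"
        by linarith
      show "forget (w (n - 1 - int ?i)) = L"
        unfolding fw i by (rule code_word_L) (simp add: mod_diff_right_eq)
    qed
  qed (rule assms(2))
  show ?thesis
    using coded_point fw by blast
qed

lemma code_word_nth:
  assumes "a < length bs" "i < N"
  shows "code_word N bs (int (a * (N + 1) + Suc i)) = bs ! a ! i"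
proof -
  have "int (a * (N + 1) + Suc i) div int (N + 1) = int a" "int (a * (N + 1) + Suc i) mod int (N + 1) = int (Suc i)"
    unfolding of_nat_div[symmetric] of_nat_mod[symmetric] using assms(2)
    by (simp_all only: div_mult_self3 mod_mult_self3) simp_all
  then show ?thesis
    using assms by (simp only: code_word_def Let_def nat_int nth_Cons_Suc) simp
qed

text \<open>Different lists of blocks give different code words, and each code word is the image
  under \<open>map forget\<close> of a realised word. Counting these images avoids keeping track of
  the first semicircle.\<close>

lemma W_count_ge:
  assumes "l \<ge> 16 * (real N + 1)"
  shows "card (zigzags L N) ^ k \<le> W_count l (k * (N + 1))"
proof -
  define Bs where "Bs = {bs. set bs \<subseteq> zigzags L N \<and> length bs = k}"
  define f where "f bs = map (\<lambda>i. code_word N bs (int i)) [0..<k * (N + 1)]" for bs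
  have "inj_on f Bs"
  proof (rule inj_onI)
    fix bs cs assume bs: "bs \<in> Bs" "cs \<in> Bs" and eq: "f bs = f cs"
    have "bs ! a ! i = cs ! a ! i" if "a < k" "i < N" for a i
    proof -
      have "a * (N + 1) + Suc i < Suc a * (N + 1)"
        using that by simp
      also have "\<dots> \<le> k * (N + 1)"
        using that by (intro mult_right_mono) auto
      finally have lt: "a * (N + 1) + Suc i < k * (N + 1)" .
      have "f bs ! (a * (N + 1) + Suc i) = f cs ! (a * (N + 1) + Suc i)"
        using eq by simp
      then have "code_word N bs (int (a * (N + 1) + Suc i)) = code_word N cs (int (a * (N + 1) + Suc i))"
        using lt by (simp only: f_def nth_map_upt diff_zero add_0)
      then show ?thesis
        using bs that by (simp only: code_word_nth Bs_def mem_Collect_eq)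
    qed
    moreover have "length (bs ! a) = N" "length (cs ! a) = N" if "a < k" for a
    proof -
      have "bs ! a \<in> zigzags L N" "cs ! a \<in> zigzags L N"
        using bs that nth_mem[of a bs] nth_mem[of a cs] by (auto simp: Bs_def)
      then show "length (bs ! a) = N" "length (cs ! a) = N"
        by (simp_all add: zigzags_def)
    qed
    ultimately show "bs = cs"
      using bs by (intro nth_equalityI) (auto simp: Bs_def intro!: nth_equalityI)
  qed
  moreover have "f ` Bs \<subseteq> map forget ` words l (k * (N + 1))"
  proof (rule image_subsetI)
    fix bs assume "bs \<in> Bs"
    then obtain x w where x: "x \<in> K_set l" "itinerary l x w" "\<And>n. forget (w n) = code_word N bs n"
      using code_word_realised[OF _ assms, of bs] by (auto simp: Bs_def)
    define u where "u = map (\<lambda>i. w (0 + int i)) [0..<k * (N + 1)]"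
    have "u \<in> words l (k * (N + 1))"
      unfolding words_def using x(1,2) by (simp only: mem_Collect_eq u_def length_map length_upt diff_zero) blast
    moreover have "f bs = map forget u"
      by (simp add: f_def u_def x(3))
    ultimately show "f bs \<in> map forget ` words l (k * (N + 1))"
      by blast
  qed
  moreover have fin: "finite (words l n)" for n
    unfolding words_def by (rule finite_lists_length_side)
  ultimately have "card Bs \<le> card (map forget ` words l (k * (N + 1)))"
    by (metis card_image card_mono finite_imageI)
  also have "\<dots> \<le> W_count l (k * (N + 1))"
    unfolding W_count_eq by (rule card_image_le[OF fin])
  finally show ?thesis
    by (simp add: Bs_def card_lists_length_eq)
qed

section \<open>Bounds for the entropy\<close>

lemma h_sym_le:
  assumes "0 < l"
  shows "h_sym l \<le> ereal (ln (1 + sqrt 2))"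
proof -
  define c where "c = ln (1 + sqrt 2)"
  have lam: "1 + sqrt 2 > (0 :: real)"
    by (simp add: add_pos_nonneg)
  have bound: "ln (real (W_count l n)) / real n \<le> ln (2 * sqrt 2) / real n + c" if "n > 0" for n
  proof -
    have "ln (real (W_count l n)) \<le> ln (2 * sqrt 2) + real n * c"
    proof (cases "W_count l n = 0")
      \<comment> \<open>Here \<open>ln 0 = 0\<close>, and the bound is nonnegative.\<close>
      case True
      have "1 \<le> 2 * sqrt 2"
        using real_sqrt_ge_one[of 2] by linarith
      then have "0 \<le> ln (2 * sqrt 2)" "0 \<le> c"
        by (simp_all add: c_def)
      then show ?thesis
        using True by simp
    next
      case False
      then have "ln (real (W_count l n)) \<le> ln (2 * sqrt 2 * (1 + sqrt 2) ^ n)"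
        using W_count_le[OF assms, of n] by (intro ln_mono) auto
      also have "\<dots> = ln (2 * sqrt 2) + real n * c"
        using lam by (subst ln_mult_pos) (auto simp: c_def ln_realpow)
      finally show ?thesis .
    qed
    then show ?thesis
      using that by (simp add: field_simps)
  qed
  have "(\<lambda>n. ln (2 * sqrt 2) / real n + c) \<longlonglongrightarrow> 0 + c"
    by (intro tendsto_intros lim_const_over_n)
  then have "(\<lambda>n. ereal (ln (2 * sqrt 2) / real n + c)) \<longlonglongrightarrow> ereal c"
    by simp
  then have "limsup (\<lambda>n. ereal (ln (2 * sqrt 2) / real n + c)) = ereal c"
    by (intro lim_imp_Limsup) auto
  moreover have "h_sym l \<le> limsup (\<lambda>n. ereal (ln (2 * sqrt 2) / real n + c))"
    unfolding h_sym_def using bound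
    by (intro Limsup_mono eventually_mono[OF eventually_gt_at_top[of 0]]) auto
  ultimately show ?thesis
    by (simp add: c_def)
qed

text \<open>Along the multiples of N + 1 every term already satisfies the bound, and a limsup
  dominates that of a subsequence.\<close>

lemma h_sym_ge:
  assumes "l \<ge> 16 * (real N + 1)"
  shows "ereal (real N / (real N + 1) * ln (1 + sqrt 2)) \<le> h_sym l"
proof -
  define X where "X = (\<lambda>n. ereal (ln (real (W_count l n)) / real n))"
  define r where "r k = k * (N + 1)" for k
  define A where "A = real (card (zigzags L N))"
  have lam: "1 + sqrt 2 > (0 :: real)"
    by (simp add: add_pos_nonneg)
  have A: "(1 + sqrt 2) ^ N \<le> A"
    using card_zigzags_ge[of N] by (simp add: A_def)
  then have A0: "0 < A"
    using lam by (metis less_le_trans zero_less_power)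
  have lnA: "real N * ln (1 + sqrt 2) \<le> ln A"
  proof -
    have "ln ((1 + sqrt 2) ^ N) \<le> ln A"
      using A lam by (intro ln_mono) auto
    then show ?thesis
      using lam by (simp add: ln_realpow)
  qed
  have "ereal (real N / (real N + 1) * ln (1 + sqrt 2)) \<le> (X \<circ> r) k" if "k > 0" for k
  proof -
    have "A ^ k \<le> real (W_count l (r k))"
      using W_count_ge[OF assms, of k] by (simp only: A_def r_def flip: of_nat_power of_nat_le_iff)
    then have "ln (A ^ k) \<le> ln (real (W_count l (r k)))"
      using A0 by (intro ln_mono) auto
    then have "real k * (real N * ln (1 + sqrt 2)) \<le> ln (real (W_count l (r k)))"
      using mult_left_mono[OF lnA, of "real k"] A0 by (simp add: ln_realpow)
    then have "real k * (real N * ln (1 + sqrt 2)) / real (r k) \<le> ln (real (W_count l (r k))) / real (r k)"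
      by (rule divide_right_mono) simp
    moreover have "real k * (real N * ln (1 + sqrt 2)) / real (r k) = real N / (real N + 1) * ln (1 + sqrt 2)"
    proof -
      have "real (r k) = real k * (real N + 1)"
        by (simp add: r_def algebra_simps)
      then show ?thesis
        using that by simp
    qed
    ultimately show ?thesis
      by (simp add: X_def)
  qed
  then have "ereal (real N / (real N + 1) * ln (1 + sqrt 2)) \<le> limsup (X \<circ> r)"
    by (intro le_Limsup eventually_mono[OF eventually_gt_at_top[of 0]]) auto
  also have "\<dots> \<le> limsup X"
  proof (rule limsup_subseq_mono)
    show "strict_mono r"
      unfolding strict_mono_def r_def by (simp only: mult_less_cancel2) simp
  qed
  finally show ?thesis
    by (simp add: h_sym_def X_def)
qed

theorem theorem4p5:
  shows "(h_sym \<longlongrightarrow> ereal (ln (1 + sqrt 2))) at_top"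
proof (rule order_tendstoI)
  fix y assume y: "y < ereal (ln (1 + sqrt 2))"
  have "(\<lambda>N. real N / (real N + 1)) \<longlonglongrightarrow> 1"
    using LIMSEQ_n_over_Suc_n[where 'a = real] by (simp only: of_nat_Suc add.commute)
  then have "(\<lambda>N. real N / (real N + 1) * ln (1 + sqrt 2)) \<longlonglongrightarrow> 1 * ln (1 + sqrt 2)"
    by (rule tendsto_mult_right)
  then have "(\<lambda>N. ereal (real N / (real N + 1) * ln (1 + sqrt 2))) \<longlonglongrightarrow> ereal (ln (1 + sqrt 2))"
    by (simp only: mult_1 tendsto_ereal)
  then have "\<forall>\<^sub>F N in sequentially. y < ereal (real N / (real N + 1) * ln (1 + sqrt 2))"
    using y by (rule order_tendstoD(1))
  then obtain N where N: "y < ereal (real N / (real N + 1) * ln (1 + sqrt 2))"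
    unfolding eventually_sequentially by blast
  \<comment> \<open>The block length \<open>N\<close> depends only on \<open>y\<close>, so every l
    from 16 (N + 1) on is admissible.\<close>
  show "\<forall>\<^sub>F l in at_top. y < h_sym l"
    using eventually_ge_at_top[of "16 * (real N + 1)"]
    by (rule eventually_mono) (rule less_le_trans[OF N h_sym_ge])
next
  fix y assume y: "ereal (ln (1 + sqrt 2)) < y"
  show "\<forall>\<^sub>F l in at_top. h_sym l < y"
    using eventually_gt_at_top[of 0] by (rule eventually_mono) (rule le_less_trans[OF h_sym_le y])
qed

end
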